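(* Let $K$ be a field, $m,n\ge 1$, let $X=(x_{ij})$ be the generic $m\times mn$ matrix, $Y=(y_{ij})$ the generic $mn\times n$ matrix, $R=K[x_{ij},y_{kl}]$ the polynomial ring in all entries of $X$ and $Y$, and $\mathfrak{I}=I_1(XY)$. For $1\le t\le n-1$ let $P_t=\sum_{s=1}^{t}I_1([X]_s[Y]_s)$. Then $P_t\cap I_1([X]_{t+1}[Y]_{t+1})=P_t\cdot I_1([X]_{t+1}[Y]_{t+1})$ for every $1\le t\le n-1$. Hence the elements $g_{ij}=\sum_{t=1}^{mn}x_{it}y_{tj}$, $1\le i\le m$, $1\le j\le n$, form a regular sequence, and the Koszul complex on them resolves $R/\mathfrak{I}$ as an $R$-module minimally.
   Context: $I_1(M)$ denotes the ideal generated by the entries of a matrix $M$. Write $X=\begin{pmatrix}A_1&\cdots&A_n\end{pmatrix}$, where $A_s$ is the $m\times m$ block of $X$ consisting of columns $m(s-1)+1,\dots,ms$. For $1\le s\le n$, $[X]_s=\begin{pmatrix}A_s&A_1&\cdots&\widehat{A_s}&\cdots&A_n\end{pmatrix}$ (the block $A_s$ is moved to the front, the other blocks keep their order), and $[Y]_s$ is the column matrix of length $mn$ obtained from the $s$-th column of $Y$ by moving the entries $y_{(m(s-1)+1)s},\dots,y_{(ms)s}$ to the top, the other entries following in their original order. Thus the entries of $[X]_s[Y]_s$ are $g_{1s},\dots,g_{ms}$. *)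

theory Defs
  imports
    "HOL-Library.Poly_Mapping"
    "HOL-Algebra.QuotRing"
    "HOL-Algebra.Ideal_Product"
    "HOL-Algebra.Module"
    "Jordan_Normal_Form.Matrix"
begin

section \<open>Modules over a commutative ring\<close>

text \<open>
  The fields \<open>mult\<close> and \<open>one\<close> of a module record carry no meaning.
\<close>

definition free_module :: "('a, 'c) ring_scheme \<Rightarrow> 'b set \<Rightarrow> ('a, 'b \<Rightarrow> 'a) module" where
  "free_module R B =
     \<lparr>carrier = B \<rightarrow>\<^sub>E carrier R, monoid.mult = undefined, monoid.one = undefined,
      zero = (\<lambda>b\<in>B. \<zero>\<^bsub>R\<^esub>), add = (\<lambda>f g. \<lambda>b\<in>B. f b \<oplus>\<^bsub>R\<^esub> g b),
      smult = (\<lambda>r f. \<lambda>b\<in>B. r \<otimes>\<^bsub>R\<^esub> f b)\<rparr>"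

definition quotient_module :: "('a, 'c) ring_scheme \<Rightarrow> 'a set \<Rightarrow> ('a, 'a set) module" where
  "quotient_module R I =
     \<lparr>carrier = carrier (R Quot I), monoid.mult = undefined, monoid.one = undefined,
      zero = \<zero>\<^bsub>R Quot I\<^esub>, add = add (R Quot I),
      smult = (\<lambda>r x. (I +>\<^bsub>R\<^esub> r) \<otimes>\<^bsub>R Quot I\<^esub> x)\<rparr>"

definition module_homs ::
  "('a, 'c) ring_scheme \<Rightarrow> ('a, 'b, 'e) module_scheme \<Rightarrow> ('a, 'd, 'f) module_scheme \<Rightarrow> ('b \<Rightarrow> 'd) set"
where
  "module_homs R M N =
     {h \<in> carrier M \<rightarrow> carrier N.
        (\<forall>x\<in>carrier M. \<forall>y\<in>carrier M. h (x \<oplus>\<^bsub>M\<^esub> y) = h x \<oplus>\<^bsub>N\<^esub> h y) \<and>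
        (\<forall>r\<in>carrier R. \<forall>x\<in>carrier M. h (r \<odot>\<^bsub>M\<^esub> x) = r \<odot>\<^bsub>N\<^esub> h x)}"

definition finite_free :: "('a, 'c) ring_scheme \<Rightarrow> ('a, 'b, 'e) module_scheme \<Rightarrow> bool" where
  "finite_free R M \<longleftrightarrow>
     (\<exists>B. finite B \<and> B \<subseteq> carrier M \<and>
        (\<forall>x\<in>carrier M. \<exists>!c. c \<in> B \<rightarrow>\<^sub>E carrier R \<and> x = (\<Oplus>\<^bsub>M\<^esub>b\<in>B. c b \<odot>\<^bsub>M\<^esub> b)))"

definition ideal_smult :: "('a, 'c) ring_scheme \<Rightarrow> 'a set \<Rightarrow> ('a, 'b) module \<Rightarrow> 'b set" where
  "ideal_smult R I M =
     \<Inter> {N. submodule N R M \<and> (\<forall>a\<in>I. \<forall>x\<in>carrier M. a \<odot>\<^bsub>M\<^esub> x \<in> N)}"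

section \<open>Free resolutions\<close>

text \<open>
  A sequence of modules \<open>F 0, F 1, \<dots>\<close> with maps \<open>d p\<close> from \<open>F (Suc p)\<close> to \<open>F p\<close>
  and an augmentation \<open>e\<close> from \<open>F 0\<close> to \<open>M\<close>.
\<close>

definition free_resolution ::
  "('a, 'c) ring_scheme \<Rightarrow> (nat \<Rightarrow> ('a, 'b) module) \<Rightarrow> (nat \<Rightarrow> 'b \<Rightarrow> 'b) \<Rightarrow> ('b \<Rightarrow> 'd) \<Rightarrow>
   ('a, 'd) module \<Rightarrow> bool"
where
  "free_resolution R F d e M \<longleftrightarrow>
     module R M \<and>
     (\<forall>p. module R (F p) \<and> finite_free R (F p)) \<and>
     (\<forall>p. d p \<in> module_homs R (F (Suc p)) (F p)) \<and>
     e \<in> module_homs R (F 0) M \<and>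
     e ` carrier (F 0) = carrier M \<and>
     a_kernel (F 0) M e = d 0 ` carrier (F 1) \<and>
     (\<forall>p. a_kernel (F (Suc p)) (F p) (d p) = d (Suc p) ` carrier (F (Suc (Suc p))))"

text \<open>
  Minimality with respect to an ideal \<open>\<mm>\<close>, which for a graded polynomial ring is the
  ideal generated by all variables: the differentials vanish modulo \<open>\<mm>\<close>.
\<close>

definition minimal_free_resolution ::
  "('a, 'c) ring_scheme \<Rightarrow> 'a set \<Rightarrow> (nat \<Rightarrow> ('a, 'b) module) \<Rightarrow> (nat \<Rightarrow> 'b \<Rightarrow> 'b) \<Rightarrow> ('b \<Rightarrow> 'd) \<Rightarrow>
   ('a, 'd) module \<Rightarrow> bool"
where
  "minimal_free_resolution R \<mm> F d e M \<longleftrightarrow>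
     free_resolution R F d e M \<and>
     (\<forall>p. d p ` carrier (F (Suc p)) \<subseteq> ideal_smult R \<mm> (F p))"

section \<open>Regular sequences and the Koszul complex\<close>

definition regular_sequence :: "('a, 'c) ring_scheme \<Rightarrow> 'a list \<Rightarrow> bool" where
  "regular_sequence R rs \<longleftrightarrow>
     set rs \<subseteq> carrier R \<and>
     (\<forall>i<length rs. let I = Idl\<^bsub>R\<^esub> (set (take i rs)) in
        \<forall>x\<in>carrier (R Quot I).
          (I +>\<^bsub>R\<^esub> (rs ! i)) \<otimes>\<^bsub>R Quot I\<^esub> x = \<zero>\<^bsub>R Quot I\<^esub> \<longrightarrow> x = \<zero>\<^bsub>R Quot I\<^esub>) \<and>
     Idl\<^bsub>R\<^esub> (set rs) \<noteq> carrier R"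

definition psubsets :: "nat \<Rightarrow> nat \<Rightarrow> nat set set" where
  "psubsets k p = {S. S \<subseteq> {..<k} \<and> card S = p}"

text \<open>
  The basis vector \<open>e\<^sub>S\<close> with \<open>S = {i\<^sub>1 < \<dots> < i\<^sub>p}\<close> stands for
  the wedge product of \<open>e\<^sub>i\<close> for \<open>i = i\<^sub>1, \<dots>, i\<^sub>p\<close>.
\<close>

definition koszul_module :: "('a, 'c) ring_scheme \<Rightarrow> 'a list \<Rightarrow> nat \<Rightarrow> ('a, nat set \<Rightarrow> 'a) module" where
  "koszul_module R rs p = free_module R (psubsets (length rs) p)"

text \<open>
  The differential sends \<open>e\<^sub>S\<close> to the alternating sum over \<open>q = 1, \<dots>, p\<close> of
  \<open>(-1)^(q-1) r\<^sub>i e\<^sub>T\<close>, where \<open>i = i\<^sub>q\<close> and \<open>T = S - {i}\<close>; here \<open>q - 1\<close> is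
  the number of elements of \<open>T\<close> below \<open>i\<close>. Collecting the coefficient of \<open>e\<^sub>T\<close>
  in the image of \<open>f\<close> gives the formula below.
\<close>

definition koszul_diff ::
  "('a, 'c) ring_scheme \<Rightarrow> 'a list \<Rightarrow> nat \<Rightarrow> (nat set \<Rightarrow> 'a) \<Rightarrow> (nat set \<Rightarrow> 'a)"
where
  "koszul_diff R rs p f =
     (\<lambda>T\<in>psubsets (length rs) p.
        \<Oplus>\<^bsub>R\<^esub>i\<in>{..<length rs} - T.
          (\<ominus>\<^bsub>R\<^esub> \<one>\<^bsub>R\<^esub>) [^]\<^bsub>R\<^esub> card {j \<in> T. j < i} \<otimes>\<^bsub>R\<^esub> (rs ! i \<otimes>\<^bsub>R\<^esub> f (insert i T)))"

definition koszul_aug :: "('a, 'c) ring_scheme \<Rightarrow> 'a set \<Rightarrow> (nat set \<Rightarrow> 'a) \<Rightarrow> 'a set" where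
  "koszul_aug R I f = I +>\<^bsub>R\<^esub> f {}"

section \<open>The polynomial ring and the generic matrices\<close>

type_synonym ('v, 'k) mpoly = "('v \<Rightarrow>\<^sub>0 nat) \<Rightarrow>\<^sub>0 'k"

definition mvar :: "'v \<Rightarrow> ('v, 'k::field) mpoly" where
  "mvar v = Poly_Mapping.single (Poly_Mapping.single v 1) 1"

definition mpoly_ring :: "'v set \<Rightarrow> ('v, 'k::field) mpoly ring" where
  "mpoly_ring V =
     \<lparr>carrier = {p. \<forall>\<mu>\<in>Poly_Mapping.keys p. Poly_Mapping.keys \<mu> \<subseteq> V},
      monoid.mult = (*), monoid.one = 1, zero = 0, add = (+)\<rparr>"

text \<open>
  All indices of variables, rows, columns and blocks start at \<open>0\<close>. In particular the
  columns of block \<open>s < n\<close> are \<open>m * s, \<dots>, m * (s + 1) - 1\<close>.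
\<close>

datatype xy = XV nat nat | YV nat nat

definition xy_vars :: "nat \<Rightarrow> nat \<Rightarrow> xy set" where
  "xy_vars m n = {XV i k |i k. i < m \<and> k < m * n} \<union> {YV k j |k j. k < m * n \<and> j < n}"

definition Rxy :: "nat \<Rightarrow> nat \<Rightarrow> (xy, 'k::field) mpoly ring" where
  "Rxy m n = mpoly_ring (xy_vars m n)"

definition irrelevant_ideal :: "nat \<Rightarrow> nat \<Rightarrow> (xy, 'k::field) mpoly set" where
  "irrelevant_ideal m n = Idl\<^bsub>Rxy m n\<^esub> (mvar ` xy_vars m n)"

definition genX :: "nat \<Rightarrow> nat \<Rightarrow> (xy, 'k::field) mpoly mat" where
  "genX m n = mat m (m * n) (\<lambda>(i, k). mvar (XV i k))"

definition genY :: "nat \<Rightarrow> nat \<Rightarrow> (xy, 'k::field) mpoly mat" where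
  "genY m n = mat (m * n) n (\<lambda>(k, j). mvar (YV k j))"

definition g :: "nat \<Rightarrow> nat \<Rightarrow> nat \<Rightarrow> nat \<Rightarrow> (xy, 'k::field) mpoly" where
  "g m n i j = (\<Sum>k<m * n. mvar (XV i k) * mvar (YV k j))"

definition I1 :: "('a, 'c) ring_scheme \<Rightarrow> 'a mat \<Rightarrow> 'a set" where
  "I1 R M = Idl\<^bsub>R\<^esub> (elements_mat M)"

definition block :: "nat \<Rightarrow> nat \<Rightarrow> nat list" where
  "block m s = [m * s..<m * (s + 1)]"

definition block_first :: "nat \<Rightarrow> nat \<Rightarrow> nat \<Rightarrow> nat list" where
  "block_first m n s = block m s @ concat (map (block m) (filter (\<lambda>u. u \<noteq> s) [0..<n]))"

definition brX :: "nat \<Rightarrow> nat \<Rightarrow> nat \<Rightarrow> (xy, 'k::field) mpoly mat" where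
  "brX m n s = mat m (m * n) (\<lambda>(i, k). genX m n $$ (i, block_first m n s ! k))"

definition brY :: "nat \<Rightarrow> nat \<Rightarrow> nat \<Rightarrow> (xy, 'k::field) mpoly mat" where
  "brY m n s = mat (m * n) 1 (\<lambda>(k, _). genY m n $$ (block_first m n s ! k, s))"

text \<open>
  The sum of the ideals of the products for the first \<open>t\<close> columns, that is for the
  column indices \<open>0, \<dots>, t - 1\<close>.
\<close>

primrec P :: "nat \<Rightarrow> nat \<Rightarrow> nat \<Rightarrow> (xy, 'k::field) mpoly set" where
  "P m n 0 = {\<zero>\<^bsub>Rxy m n\<^esub>}"
| "P m n (Suc t) = P m n t <+>\<^bsub>Rxy m n\<^esub> I1 (Rxy m n) (brX m n t * brY m n t)"

end

theory Submission
  imports Defs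
begin

text \<open>
  Give the variable \<open>x\<^sub>i\<^sub>k\<close> weight one if \<open>k\<close> is the \<open>i\<close>-th index of its block, give
  \<open>y\<^sub>k\<^sub>j\<close> weight one if \<open>k\<close> lies in the \<open>j\<close>-th block, and give all other variables weight zero.
  Among the products \<open>x\<^sub>i\<^sub>k y\<^sub>k\<^sub>j\<close> that make up \<open>g\<^sub>i\<^sub>j\<close> exactly one has
  weight two, namely the one in which \<open>k\<close> is the \<open>i\<close>-th index of the \<open>j\<close>-th block. So the leading
  form of \<open>g\<^sub>i\<^sub>j\<close> is a monomial \<open>u\<^sub>i\<^sub>j\<close>, and these monomials involve
  pairwise disjoint sets of variables. All claims hold for the \<open>u\<^sub>i\<^sub>j\<close>; the point is to
  carry them over to the \<open>g\<^sub>i\<^sub>j\<close>.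

  Write a monomial as \<open>b \<cdot> \<Prod> u\<^sub>i\<^sub>j ^ a\<^sub>i\<^sub>j\<close> with the largest possible
  exponents and let \<open>\<Phi>\<close> be the linear map that sends it to
  \<open>b \<cdot> \<Prod> g\<^sub>i\<^sub>j ^ a\<^sub>i\<^sub>j\<close>. It changes a polynomial only by terms of lower
  weight, so it is bijective, and it satisfies \<open>\<Phi> (u\<^sub>i\<^sub>j p) = g\<^sub>i\<^sub>j \<Phi> p\<close>.
  Thus \<open>\<Phi>\<close> turns multiplication by the \<open>u\<^sub>i\<^sub>j\<close> into multiplication by the
  \<open>g\<^sub>i\<^sub>j\<close>. Dividing by \<open>u\<^sub>i\<^sub>j\<close>, where a monomial that is not divisible goes to zero,
  becomes under \<open>\<Phi>\<close> an additive operator \<open>D\<^sub>i\<^sub>j\<close> that undoes multiplication by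
  \<open>g\<^sub>i\<^sub>j\<close> and commutes with multiplication by every other member of the family
  (theorem \<open>ex_retracted_family\<close>).

  The existence of such operators gives everything. If \<open>g\<^sub>i\<^sub>j x\<close> lies in the ideal of other
  members, applying \<open>D\<^sub>i\<^sub>j\<close> shows that \<open>x\<close> does, hence regularity in every order
  (\<open>nonzerodivisor_modulo\<close>). The operators \<open>x \<mapsto> x - g\<^sub>i\<^sub>j D\<^sub>i\<^sub>j x\<close> kill the
  multiples of one generator and preserve the ideal of the others, so the intersection of two ideals
  generated by disjoint subfamilies is their product (\<open>intersection_induct\<close>). Finally \<open>D\<^sub>i\<^sub>j\<close>
  followed by the wedge product with the corresponding basis vector is a homotopy on the Koszul complex
  that contracts it in positive degrees (\<open>koszul_exact\<close>). Minimality holds because every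
  \<open>g\<^sub>i\<^sub>j\<close> lies in the ideal of all variables.
\<close>

section \<open>Families of ring elements with commuting retractions\<close>

text \<open>
  The polynomial ring in a subset of the variables is a subset of a type of commutative rings, so the
  arguments about elements are carried out there, with the type class operations and a subset \<open>C\<close>
  closed under them.
\<close>

locale unital_subring =
  fixes C :: "'a::comm_ring_1 set"
  assumes one_mem: "1 \<in> C"
    and add_mem: "\<And>x y. x \<in> C \<Longrightarrow> y \<in> C \<Longrightarrow> x + y \<in> C"
    and uminus_mem: "\<And>x. x \<in> C \<Longrightarrow> - x \<in> C"
    and mult_mem: "\<And>x y. x \<in> C \<Longrightarrow> y \<in> C \<Longrightarrow> x * y \<in> C"
begin

lemma zero_mem: "0 \<in> C"
  using add_mem[OF one_mem uminus_mem[OF one_mem]] by simp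

lemma diff_mem: "x \<in> C \<Longrightarrow> y \<in> C \<Longrightarrow> x - y \<in> C"
  using add_mem[OF _ uminus_mem, of x y] by simp

lemma sum_mem: "(\<And>i. i \<in> A \<Longrightarrow> f i \<in> C) \<Longrightarrow> sum f A \<in> C"
  by (induction A rule: infinite_finite_induct) (auto simp: zero_mem add_mem)

lemma prod_mem: "(\<And>i. i \<in> A \<Longrightarrow> f i \<in> C) \<Longrightarrow> prod f A \<in> C"
  by (induction A rule: infinite_finite_induct) (auto simp: one_mem mult_mem)

lemma power_mem: "x \<in> C \<Longrightarrow> x ^ n \<in> C"
  by (induction n) (auto simp: one_mem mult_mem)

lemma sign_mem: "(- 1) ^ n \<in> C"
  by (intro power_mem uminus_mem one_mem)

end

text \<open>
  The ideal of \<open>C\<close> generated by the family \<open>r\<close> over a finite index set \<open>J\<close>.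
\<close>

definition comb_span :: "'a::comm_ring_1 set \<Rightarrow> ('i \<Rightarrow> 'a) \<Rightarrow> 'i set \<Rightarrow> 'a set" where
  "comb_span C r J = {\<Sum>i\<in>J. r i * c i |c. c \<in> J \<rightarrow> C}"

lemma comb_spanI: "c \<in> J \<rightarrow> C \<Longrightarrow> x = (\<Sum>i\<in>J. r i * c i) \<Longrightarrow> x \<in> comb_span C r J"
  by (auto simp: comb_span_def)

lemma comb_spanE:
  assumes "x \<in> comb_span C r J"
  obtains c where "c \<in> J \<rightarrow> C" "x = (\<Sum>i\<in>J. r i * c i)"
  using assms by (auto simp: comb_span_def)

lemma comb_span_union:
  fixes R :: "'a::comm_ring_1 ring"
  assumes "add R = (+)" "finite J" "finite J'" "J \<inter> J' = {}"
  shows "comb_span C r (J \<union> J') = comb_span C r J <+>\<^bsub>R\<^esub> comb_span C r J'"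
proof (intro equalityI subsetI)
  fix x assume "x \<in> comb_span C r (J \<union> J')"
  then obtain c where c: "c \<in> J \<union> J' \<rightarrow> C" "x = (\<Sum>i\<in>J \<union> J'. r i * c i)" by (rule comb_spanE)
  then have "x = (\<Sum>i\<in>J. r i * c i) + (\<Sum>i\<in>J'. r i * c i)"
    using assms by (simp add: sum.union_disjoint)
  moreover have "(\<Sum>i\<in>J. r i * c i) \<in> comb_span C r J" "(\<Sum>i\<in>J'. r i * c i) \<in> comb_span C r J'"
    using c(1) by (auto intro: comb_spanI[of c])
  ultimately show "x \<in> comb_span C r J <+>\<^bsub>R\<^esub> comb_span C r J'"
    using assms(1) by (auto simp: set_add_def')
next
  fix x assume "x \<in> comb_span C r J <+>\<^bsub>R\<^esub> comb_span C r J'"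
  then obtain y z where yz: "y \<in> comb_span C r J" "z \<in> comb_span C r J'" "x = y + z"
    using assms(1) by (auto simp: set_add_def')
  obtain a where a: "a \<in> J \<rightarrow> C" "y = (\<Sum>i\<in>J. r i * a i)" using yz(1) by (rule comb_spanE)
  obtain b where b: "b \<in> J' \<rightarrow> C" "z = (\<Sum>i\<in>J'. r i * b i)" using yz(2) by (rule comb_spanE)
  let ?c = "\<lambda>i. if i \<in> J then a i else b i"
  show "x \<in> comb_span C r (J \<union> J')"
  proof (rule comb_spanI[of ?c])
    show "?c \<in> J \<union> J' \<rightarrow> C" using a(1) b(1) by auto
    have "(\<Sum>i\<in>J'. r i * ?c i) = (\<Sum>i\<in>J'. r i * b i)"
      using assms(4) by (intro sum.cong) auto
    then show "x = (\<Sum>i\<in>J \<union> J'. r i * ?c i)"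
      using assms a(2) b(2) yz(3) by (simp add: sum.union_disjoint)
  qed
qed

lemma (in unital_subring) comb_span_generator:
  assumes "finite J" "i \<in> J"
  shows "r i \<in> comb_span C r J"
  by (rule comb_spanI[of "\<lambda>j. if j = i then 1 else 0"])
    (use assms in \<open>auto simp: one_mem zero_mem if_distrib cong: if_cong\<close>)

text \<open>
  The operator \<open>D i\<close> is a left inverse of multiplication by \<open>r i\<close> and linear over the other members
  of the family. The model is a polynomial ring with variables \<open>r i\<close>, where \<open>D i\<close> divides by \<open>r i\<close> and
  drops the monomials without it.
\<close>

locale retracted_family = unital_subring C
  for C :: "'a::comm_ring_1 set" +
  fixes \<Lambda> :: "'i set" and r :: "'i \<Rightarrow> 'a" and D :: "'i \<Rightarrow> 'a \<Rightarrow> 'a"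
  assumes finite_index: "finite \<Lambda>"
    and r_mem: "i \<in> \<Lambda> \<Longrightarrow> r i \<in> C"
    and D_mem: "i \<in> \<Lambda> \<Longrightarrow> x \<in> C \<Longrightarrow> D i x \<in> C"
    and D_add: "i \<in> \<Lambda> \<Longrightarrow> D i (x + y) = D i x + D i y"
    and D_retract: "i \<in> \<Lambda> \<Longrightarrow> D i (r i * x) = x"
    and D_commute: "i \<in> \<Lambda> \<Longrightarrow> j \<in> \<Lambda> \<Longrightarrow> i \<noteq> j \<Longrightarrow> D i (r j * x) = r j * D i x"
begin

lemma D_zero: "i \<in> \<Lambda> \<Longrightarrow> D i 0 = 0"
  using D_add[of i 0 0] by simp

lemma D_sum: "i \<in> \<Lambda> \<Longrightarrow> D i (\<Sum>a\<in>A. f a) = (\<Sum>a\<in>A. D i (f a))"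
  by (induction A rule: infinite_finite_induct) (auto simp: D_zero D_add)

lemma D_uminus: "i \<in> \<Lambda> \<Longrightarrow> D i (- x) = - D i x"
  using D_add[of i x "- x"] by (simp add: D_zero add_eq_0_iff)

lemma D_sign: "i \<in> \<Lambda> \<Longrightarrow> D i ((- 1) ^ n * x) = (- 1) ^ n * D i x"
  by (cases "even n") (auto simp: D_uminus)

lemma D_comb_span:
  assumes "J \<subseteq> \<Lambda>" "i \<in> \<Lambda>" "i \<notin> J" "x \<in> comb_span C r J"
  shows "D i x \<in> comb_span C r J"
proof -
  obtain c where c: "c \<in> J \<rightarrow> C" "x = (\<Sum>j\<in>J. r j * c j)"
    using assms(4) by (rule comb_spanE)
  have "D i x = (\<Sum>j\<in>J. r j * D i (c j))"
    unfolding c(2) D_sum[OF assms(2)] using assms by (auto intro!: sum.cong D_commute)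
  moreover have "(\<lambda>j. D i (c j)) \<in> J \<rightarrow> C"
    using c(1) D_mem[OF assms(2)] by auto
  ultimately show ?thesis by (intro comb_spanI)
qed

text \<open>
  Applying \<open>D i\<close> to \<open>r i * x\<close> returns \<open>x\<close>, and \<open>D i\<close> preserves the ideal generated by the other
  members.
\<close>

theorem nonzerodivisor_modulo:
  assumes "J \<subseteq> \<Lambda>" "i \<in> \<Lambda>" "i \<notin> J" "r i * x \<in> comb_span C r J"
  shows "x \<in> comb_span C r J"
  using D_comb_span[OF assms] assms(2) by (simp add: D_retract)

text \<open>
  Membership in the product of the two ideals, phrased as an induction rule: \<open>N\<close> stands for a set that
  contains the products of multiples of generators and is closed under addition. The proof removes the
  generators of the second ideal one at a time. For a generator \<open>r j\<close> split \<open>x\<close> into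
  \<open>r j * D j x\<close>, which lies in the product because \<open>D j x\<close> is still in the first ideal, and
  \<open>x - r j * D j x\<close>, which is still in the first ideal and in which the \<open>r j\<close> term of a representation
  by generators of the second ideal has cancelled.
\<close>

theorem intersection_induct:
  assumes "J \<subseteq> \<Lambda>" "J' \<subseteq> \<Lambda>" "J \<inter> J' = {}"
    and "x \<in> comb_span C r J" "x \<in> comb_span C r J'"
    and zero: "0 \<in> N" and add: "\<And>a b. a \<in> N \<Longrightarrow> b \<in> N \<Longrightarrow> a + b \<in> N"
    and prod: "\<And>i j c. i \<in> J \<Longrightarrow> j \<in> J' \<Longrightarrow> c \<in> C \<Longrightarrow> r i * c * r j \<in> N"
  shows "x \<in> N"
proof -
  have "finite J'" using assms(2) finite_index by (rule finite_subset)
  then show ?thesis using assms(2-5) prod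
  proof (induction J' arbitrary: x rule: finite_induct)
    case empty
    then show ?case using zero by (auto elim: comb_spanE)
  next
    case (insert j J')
    have j: "j \<in> \<Lambda>" "j \<notin> J" using insert.prems by auto
    have N_sum: "(\<Sum>a\<in>A. f a) \<in> N" if "\<And>a. a \<in> A \<Longrightarrow> f a \<in> N" for f and A :: "'i set"
      using that by (induction A rule: infinite_finite_induct) (auto simp: zero add)
    have fin: "finite J" using assms(1) finite_index by (rule finite_subset)
    \<comment> \<open>the part of \<open>x\<close> that no longer needs the generator \<open>r j\<close>\<close>
    define y where "y = x - r j * D j x"
    obtain a where a: "a \<in> J \<rightarrow> C" "D j x = (\<Sum>i\<in>J. r i * a i)"
      using D_comb_span[OF assms(1) j insert.prems(3)] by (rule comb_spanE)
    obtain b where b: "b \<in> J \<rightarrow> C" "x = (\<Sum>i\<in>J. r i * b i)"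
      using insert.prems(3) by (rule comb_spanE)
    obtain c where c: "c \<in> insert j J' \<rightarrow> C" "x = (\<Sum>i\<in>insert j J'. r i * c i)"
      using insert.prems(4) by (rule comb_spanE)
    have "y \<in> comb_span C r J"
    proof (rule comb_spanI[of "\<lambda>i. b i - r j * a i"])
      show "(\<lambda>i. b i - r j * a i) \<in> J \<rightarrow> C"
        using a(1) b(1) j(1) by (auto intro!: diff_mem mult_mem r_mem)
      show "y = (\<Sum>i\<in>J. r i * (b i - r j * a i))"
        unfolding y_def a(2) using b(2)
        by (simp add: sum_subtractf right_diff_distrib sum_distrib_left mult.left_commute)
    qed
    moreover have "y \<in> comb_span C r J'"
    proof (rule comb_spanI[of "\<lambda>i. c i - r j * D j (c i)"])
      show "(\<lambda>i. c i - r j * D j (c i)) \<in> J' \<rightarrow> C"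
        using c(1) j(1) by (auto intro!: diff_mem mult_mem r_mem D_mem)
      have x: "x = r j * c j + (\<Sum>i\<in>J'. r i * c i)"
        unfolding c(2) by (rule sum.insert[OF insert.hyps])
      have "D j (r i * c i) = r i * D j (c i)" if "i \<in> J'" for i
        using that insert.hyps insert.prems(1) by (intro D_commute) auto
      then have "D j x = c j + (\<Sum>i\<in>J'. r i * D j (c i))"
        unfolding x using j(1) by (simp add: D_add D_sum D_retract)
      then show "y = (\<Sum>i\<in>J'. r i * (c i - r j * D j (c i)))"
        unfolding y_def by (subst x)
          (simp add: sum_subtractf right_diff_distrib distrib_left sum_distrib_left mult.left_commute)
    qed
    ultimately have "y \<in> N"
    proof (rule insert.IH[rotated 2])
      show "J' \<subseteq> \<Lambda>" "J \<inter> J' = {}" using insert.prems(1,2) by auto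
      show "r i * c * r l \<in> N" if "i \<in> J" "l \<in> J'" "c \<in> C" for i l c
        using that by (intro insert.prems(5)) auto
    qed
    moreover have "r j * D j x \<in> N"
      unfolding a(2) sum_distrib_left
    proof (rule N_sum)
      show "r j * (r i * a i) \<in> N" if "i \<in> J" for i
        using that a(1) insert.prems(5)[of i j "a i"] by (auto simp: mult.commute[of "r j"])
    qed
    ultimately show ?case
      using add[of y "r j * D j x"] by (simp add: y_def)
  qed
qed

lemma reindex_list:
  assumes "distinct ps" "set ps = \<Lambda>"
  shows "retracted_family C {..<length (map r ps)} ((!) (map r ps)) (\<lambda>k. D (ps ! k))"
proof
  fix k l x assume k: "k \<in> {..<length (map r ps)}" and l: "l \<in> {..<length (map r ps)}" and "k \<noteq> l"
  then show "D (ps ! k) (map r ps ! l * x) = map r ps ! l * D (ps ! k) x"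
    using assms by (simp add: D_commute nth_eq_iff_index_eq flip: assms(2))
qed (use assms(2) in \<open>auto simp: r_mem D_mem D_add D_retract\<close>)

end

section \<open>The Koszul complex of a retracted family\<close>

text \<open>
  The coefficient at \<open>T\<close> of the Koszul differential, without keeping track of the degree: \<open>f\<close> may
  have coefficients at sets of every cardinality.
\<close>

definition koszul_coeff :: "nat \<Rightarrow> (nat \<Rightarrow> 'a::comm_ring_1) \<Rightarrow> (nat set \<Rightarrow> 'a) \<Rightarrow> nat set \<Rightarrow> 'a" where
  "koszul_coeff k r f T =
     (\<Sum>i\<in>{..<k} - T. (- 1) ^ card {j \<in> T. j < i} * (r i * f (insert i T)))"

lemma card_below_insert:
  assumes "finite T" "i \<notin> T"
  shows "card {j \<in> insert i T. j < l} = card {j \<in> T. j < l} + (if i < l then 1 else 0)"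
proof -
  have "{j \<in> insert i T. j < l} = (if i < l then insert i {j \<in> T. j < l} else {j \<in> T. j < l})"
    by auto
  then show ?thesis using assms by auto
qed

text \<open>
  Removing \<open>i\<close> and \<open>l\<close> in the two possible orders gives the same term with opposite signs, because
  only the larger of the two indices notices whether the smaller one is present.
\<close>

lemma koszul_coeff_koszul_coeff:
  assumes "finite T"
  shows "koszul_coeff k r (koszul_coeff k r f) T = 0"
proof -
  define A where "A = {..<k} - T"
  define t where "t i l = ((- 1) ^ (card {j \<in> T. j < i} + card {j \<in> insert i T. j < l})
      * (r i * r l * f (insert i (insert l T))))" for i l
  have "koszul_coeff k r (koszul_coeff k r f) T = (\<Sum>i\<in>A. \<Sum>l\<in>A - {i}. t i l)"
    unfolding koszul_coeff_def A_def t_def sum_distrib_left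
    by (intro sum.cong) (auto simp: power_add ac_simps insert_commute)
  also have "\<dots> = (\<Sum>(i, l)\<in>(SIGMA i:A. A - {i}). t i l)"
    by (simp add: sum.Sigma A_def)
  also have "(SIGMA i:A. A - {i}) = {(i, l) \<in> A \<times> A. i < l} \<union> {(i, l) \<in> A \<times> A. l < i}"
    by auto
  also have "(\<Sum>(i, l)\<in>\<dots>. t i l) =
      (\<Sum>(i, l)\<in>{(i, l) \<in> A \<times> A. i < l}. t i l) + (\<Sum>(i, l)\<in>{(i, l) \<in> A \<times> A. l < i}. t i l)"
    by (intro sum.union_disjoint) (auto simp: A_def intro: finite_subset[of _ "A \<times> A"])
  also have "(\<Sum>(i, l)\<in>{(i, l) \<in> A \<times> A. l < i}. t i l) =
      (\<Sum>(i, l)\<in>{(i, l) \<in> A \<times> A. i < l}. t l i)"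
    by (rule sum.reindex_bij_witness[of _ prod.swap prod.swap]) auto
  also have "(\<Sum>(i, l)\<in>{(i, l) \<in> A \<times> A. i < l}. t i l) + \<dots> =
      (\<Sum>(i, l)\<in>{(i, l) \<in> A \<times> A. i < l}. t i l + t l i)"
    by (simp add: sum.distrib case_prod_unfold)
  also have "\<dots> = 0"
  proof (intro sum.neutral ballI, clarsimp)
    fix i l assume "i \<in> A" "l \<in> A" "i < l"
    then have "card {j \<in> insert i T. j < l} = Suc (card {j \<in> T. j < l})"
      "card {j \<in> insert l T. j < i} = card {j \<in> T. j < i}"
      using assms card_below_insert[of T i l] card_below_insert[of T l i] by (simp_all add: A_def del: insert_iff)
    then show "t i l + t l i = 0"
      by (simp add: t_def insert_commute[of i l] add.commute mult.commute[of "r i"])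
  qed
  finally show ?thesis .
qed

lemma koszul_coeff_diff:
  "koszul_coeff k r (\<lambda>S. f S - h S) T = koszul_coeff k r f T - koszul_coeff k r h T"
  by (simp add: koszul_coeff_def right_diff_distrib sum_subtractf)

lemma koszul_coeff_add:
  "koszul_coeff k r (\<lambda>S. f S + h S) T = koszul_coeff k r f T + koszul_coeff k r h T"
  by (simp add: koszul_coeff_def distrib_left sum.distrib)

locale retracted_list = retracted_family C "{..<k}" r D
  for C :: "'a::comm_ring_1 set" and k :: nat and r :: "nat \<Rightarrow> 'a" and D :: "nat \<Rightarrow> 'a \<Rightarrow> 'a"
begin

lemma koszul_coeff_mem: 
  "(\<And>S. S \<subseteq> {..<k} \<Longrightarrow> f S \<in> C) \<Longrightarrow> T \<subseteq> {..<k} \<Longrightarrow> koszul_coeff k r f T \<in> C"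
  unfolding koszul_coeff_def by (intro sum_mem mult_mem sign_mem r_mem) auto

text \<open>
  The wedge product with the \<open>j\<close>-th basis vector after \<open>D j\<close> on coefficients, with the sign
  conventions of the differential.
\<close>

definition homotopy :: "nat \<Rightarrow> (nat set \<Rightarrow> 'a) \<Rightarrow> nat set \<Rightarrow> 'a" where
  "homotopy j f S = (if j \<in> S then (- 1) ^ card {i \<in> S. i < j} * D j (f (S - {j})) else 0)"

text \<open>
  At a set \<open>S\<close> without \<open>j\<close> the differential of \<open>homotopy j f\<close> only sees the term that inserts \<open>j\<close>.
\<close>

lemma koszul_homotopy_notin:
  assumes "j < k" "S \<subseteq> {..<k}" "j \<notin> S"
  shows "koszul_coeff k r (homotopy j f) S = r j * D j (f S)"
proof -
  have "koszul_coeff k r (homotopy j f) S =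
     (\<Sum>i\<in>{..<k} - S. if i = j then r j * D j (f S) else 0)"
    unfolding koszul_coeff_def
  proof (intro sum.cong refl)
    fix i assume i: "i \<in> {..<k} - S"
    have "finite S" using assms(2) by (rule finite_subset) simp
    then have eq: "card {l \<in> insert j S. l < j} = card {l \<in> S. l < j}"
      using assms(3) card_below_insert[of S j j] by (simp del: insert_iff)
    \<comment> \<open>the sign of the homotopy cancels the sign of the differential\<close>
    have sq: "(- 1) ^ n * (r j * ((- 1) ^ n * y)) = r j * y" for n and y :: 'a
      by (cases "even n") auto
    show "(- 1) ^ card {j \<in> S. j < i} * (r i * homotopy j f (insert i S)) =
         (if i = j then r j * D j (f S) else 0)"
    proof (cases "i = j")
      case True
      have "homotopy j f (insert j S) = (- 1) ^ card {l \<in> S. l < j} * D j (f S)"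
        unfolding homotopy_def eq using assms(3) by simp
      then show ?thesis using True by (simp add: sq)
    next
      case False
      then have "homotopy j f (insert i S) = 0"
        using assms(3) by (simp add: homotopy_def)
      then show ?thesis using False by simp
    qed
  qed
  also have "\<dots> = r j * D j (f S)"
    using assms by (simp add: sum.delta)
  finally show ?thesis .
qed

text \<open>
  At a set containing \<open>j\<close> the homotopy reproduces a cycle: applying \<open>D j\<close> to the cycle condition at
  \<open>S - {j}\<close> isolates \<open>f S\<close> in the term for \<open>j\<close>, and the remaining terms are, up to sign, the
  differential of the homotopy.
\<close>

lemma koszul_homotopy_in:
  assumes "j \<in> S" "S \<subseteq> {..<k}" and cycle: "koszul_coeff k r f (S - {j}) = 0"
  shows "koszul_coeff k r (homotopy j f) S = f S"
proof -
  define T where "T = S - {j}"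
  have S: "S = insert j T" "j \<notin> T" using assms(1) by (auto simp: T_def)
  have fin: "finite T" using assms(2) S by (auto intro: finite_subset)
  have j: "j < k" using assms by auto
  let ?n = "\<lambda>i. card {l \<in> T. l < i}"
  let ?w = "\<lambda>i. (- 1) ^ ?n i * (r i * D j (f (insert i S)))"
  let ?v = "\<lambda>i. (- 1) ^ ?n i * (r i * D j (f (insert i T)))"
  have "0 = D j (koszul_coeff k r f T)"
    using cycle j by (simp add: T_def D_zero)
  also have "\<dots> = (\<Sum>i\<in>{..<k} - T. D j ((- 1) ^ ?n i * (r i * f (insert i T))))"
    using j by (simp add: koszul_coeff_def D_sum)
  also have "{..<k} - T = insert j ({..<k} - S)"
    using S j by auto
  also have "(\<Sum>i\<in>insert j ({..<k} - S). D j ((- 1) ^ ?n i * (r i * f (insert i T)))) =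
      (- 1) ^ ?n j * f S + (\<Sum>i\<in>{..<k} - S. ?v i)"
  proof (subst sum.insert)
    have "D j ((- 1) ^ ?n i * (r i * f (insert i T))) = ?v i" if "i \<in> {..<k} - S" for i
      using that S j by (auto simp: D_sign D_commute)
    then show "D j ((- 1) ^ ?n j * (r j * f (insert j T))) +
        (\<Sum>i\<in>{..<k} - S. D j ((- 1) ^ ?n i * (r i * f (insert i T)))) =
        (- 1) ^ ?n j * f S + (\<Sum>i\<in>{..<k} - S. ?v i)"
      using S(1) j by (simp add: D_sign D_retract)
  qed (use S in auto)
  finally have "(\<Sum>i\<in>{..<k} - S. ?v i) = - ((- 1) ^ ?n j * f S)"
    by (simp add: eq_neg_iff_add_eq_0 add.commute)
  then have cyc: "f S = - ((- 1) ^ ?n j * (\<Sum>i\<in>{..<k} - S. ?v i))"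
    by (cases "even (?n j)") simp_all
  have "koszul_coeff k r (homotopy j f) S = (\<Sum>i\<in>{..<k} - S. - ((- 1) ^ ?n j * ?v i))"
    unfolding koszul_coeff_def
  proof (intro sum.cong refl)
    fix i assume i: "i \<in> {..<k} - S"
    have eq: "insert i S - {j} = insert i T" using i S by auto
    have eq2: "card {l \<in> S. l < i} = ?n i + (if j < i then 1 else 0)"
      unfolding S(1) by (rule card_below_insert[OF fin S(2)])
    have "card {l \<in> insert i S. l < j} = card {l \<in> insert i T. l < j}"
      by (rule arg_cong[of _ _ card]) (auto simp: S(1))
    also have "\<dots> = ?n j + (if i < j then 1 else 0)"
      using i S by (intro card_below_insert[OF fin]) auto
    finally have eq3: "card {l \<in> insert i S. l < j} = ?n j + (if i < j then 1 else 0)" .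
    show "(- 1) ^ card {l \<in> S. l < i} * (r i * homotopy j f (insert i S)) = - ((- 1) ^ ?n j * ?v i)"
      using i assms(1) unfolding homotopy_def eq eq2 eq3
      by (cases "even (?n i)"; cases "even (?n j)") auto
  qed
  also have "\<dots> = f S"
    by (simp add: cyc sum_negf sum_distrib_left)
  finally show ?thesis .
qed

text \<open>
  Subtracting from a cycle \<open>f\<close> the boundary of \<open>homotopy j f\<close> makes its coefficients vanish at
  all sets containing \<open>j\<close>, and at a set \<open>S\<close> without \<open>j\<close> leaves \<open>f S - r j * D j (f S)\<close>,
  which is zero if \<open>f S\<close> was. So the indices can be treated one after the other, until only the
  coefficient at the empty set is left.
\<close>

theorem koszul_exact:
  assumes f: "\<And>S. S \<subseteq> {..<k} \<Longrightarrow> f S \<in> C"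
    and cycle: "\<And>T. T \<subseteq> {..<k} \<Longrightarrow> koszul_coeff k r f T = 0"
  obtains h where "\<And>S. S \<subseteq> {..<k} \<Longrightarrow> h S \<in> C"
    and "\<And>S. S \<subseteq> {..<k} \<Longrightarrow> S \<noteq> {} \<Longrightarrow> f S = koszul_coeff k r h S"
proof -
  have "\<exists>h. (\<forall>S\<subseteq>{..<k}. h S \<in> C) \<and>
      (\<forall>S\<subseteq>{..<k}. S \<inter> {..<j} \<noteq> {} \<longrightarrow> f S = koszul_coeff k r h S)" if "j \<le> k" for j
    using that
  proof (induction j)
    case 0
    then show ?case by (auto intro!: exI[of _ "\<lambda>_. 0"] zero_mem)
  next
    case (Suc j)
    then obtain h where h: "\<And>S. S \<subseteq> {..<k} \<Longrightarrow> h S \<in> C"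
      "\<And>S. S \<subseteq> {..<k} \<Longrightarrow> S \<inter> {..<j} \<noteq> {} \<Longrightarrow> f S = koszul_coeff k r h S"
      by auto
    have j: "j < k" using Suc.prems by simp
    define f' where "f' = (\<lambda>S. f S - koszul_coeff k r h S)"
    have f': "f' S \<in> C" if "S \<subseteq> {..<k}" for S
      using that f h(1) by (auto simp: f'_def intro!: diff_mem koszul_coeff_mem)
    have cycle': "koszul_coeff k r f' T = 0" if "T \<subseteq> {..<k}" for T
      using that cycle[OF that] finite_subset[OF that]
      by (simp add: f'_def koszul_coeff_diff koszul_coeff_koszul_coeff)
    have hom: "homotopy j f' S \<in> C" if "S \<subseteq> {..<k}" for S
      using that j by (auto simp: homotopy_def intro!: mult_mem sign_mem D_mem f' zero_mem)
    show ?case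
    proof (intro exI[of _ "\<lambda>S. h S + homotopy j f' S"] conjI allI impI)
      fix S assume S: "S \<subseteq> {..<k}"
      show "h S + homotopy j f' S \<in> C" using h(1) hom S by (auto intro: add_mem)
      assume meet: "S \<inter> {..<Suc j} \<noteq> {}"
      have "koszul_coeff k r (homotopy j f') S = f' S"
      proof (cases "j \<in> S")
        case True
        then show ?thesis using S by (intro koszul_homotopy_in cycle') auto
      next
        case False
        then have "f' S = 0"
          using h(2)[OF S] meet by (auto simp: f'_def lessThan_Suc)
        then show ?thesis using False S j by (simp add: koszul_homotopy_notin D_zero)
      qed
      then show "f S = koszul_coeff k r (\<lambda>S. h S + homotopy j f' S) S"
        by (simp add: koszul_coeff_add f'_def)
    qed
  qed
  from this[of k] show ?thesis
    using that by (auto simp: Int_absorb2)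
qed

end

section \<open>Ideals and quotients of a subring as a ring record\<close>

text \<open>
  The link between the type class operations on \<open>C\<close> and the record operations in which ideals,
  quotients and modules are expressed.
\<close>

locale explicit_ring = unital_subring C
  for C :: "'a::comm_ring_1 set" +
  fixes R :: "'a ring"
  assumes carrier_eq: "carrier R = C"
    and mult_eq: "monoid.mult R = (*)"
    and one_eq: "monoid.one R = 1"
    and zero_eq: "zero R = 0"
    and add_eq: "add R = (+)"
begin

lemmas ring_eqs = carrier_eq mult_eq one_eq zero_eq add_eq

lemma cring: "cring R"
proof (rule cringI)
  show "abelian_group R"
    by (rule abelian_groupI)
      (auto simp: ring_eqs add.assoc add.commute add_mem zero_mem intro!: bexI[OF _ uminus_mem])
  show "comm_monoid R"
    by (rule comm_monoidI) (auto simp: ring_eqs mult.assoc mult.commute mult_mem one_mem)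
qed (auto simp: ring_eqs distrib_right)

sublocale R: cring R by (rule cring)

lemma a_inv_eq: "x \<in> C \<Longrightarrow> \<ominus>\<^bsub>R\<^esub> x = - x"
  by (rule R.minus_equality) (auto simp: ring_eqs uminus_mem)

lemma finsum_eq: "f \<in> A \<rightarrow> C \<Longrightarrow> finsum R f A = sum f A"
  by (induction A rule: infinite_finite_induct) (auto simp: ring_eqs R.finsum_insert)

lemma nat_pow_eq: "x [^]\<^bsub>R\<^esub> (n::nat) = x ^ n"
  by (induction n) (auto simp: ring_eqs nat_pow_def mult.commute)

lemma sign_eq: "(\<ominus>\<^bsub>R\<^esub> \<one>\<^bsub>R\<^esub>) [^]\<^bsub>R\<^esub> (n::nat) = (- 1) ^ n"
  using a_inv_eq[OF one_mem] by (simp add: nat_pow_eq one_eq)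

lemma ideal_sum:
  assumes "ideal I R" "\<And>a. a \<in> A \<Longrightarrow> F a \<in> I"
  shows "sum F A \<in> I"
proof -
  interpret ideal I R by fact
  show ?thesis using assms(2)
  proof (induction A rule: infinite_finite_induct)
    case (insert a A)
    then show ?case using a_closed by (auto simp: ring_eqs)
  qed (use zero_closed in \<open>auto simp: ring_eqs\<close>)
qed

lemma ideal_comb_span:
  assumes r: "\<And>i. i \<in> J \<Longrightarrow> r i \<in> C"
  shows "ideal (comb_span C r J) R"
proof (rule idealI)
  show "ring R" by (rule R.ring_axioms)
  have add: "x + y \<in> comb_span C r J"
    if x: "x \<in> comb_span C r J" and y: "y \<in> comb_span C r J" for x y
  proof -
    obtain a where a: "a \<in> J \<rightarrow> C" "x = (\<Sum>i\<in>J. r i * a i)" using x by (rule comb_spanE)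
    obtain b where b: "b \<in> J \<rightarrow> C" "y = (\<Sum>i\<in>J. r i * b i)" using y by (rule comb_spanE)
    show ?thesis
      by (rule comb_spanI[of "\<lambda>i. a i + b i"])
        (use a b in \<open>auto simp: distrib_left sum.distrib intro!: add_mem\<close>)
  qed
  have mult: "x * y \<in> comb_span C r J" if x: "x \<in> comb_span C r J" and y: "y \<in> C" for x y
  proof -
    obtain a where a: "a \<in> J \<rightarrow> C" "x = (\<Sum>i\<in>J. r i * a i)" using x by (rule comb_spanE)
    show ?thesis
      by (rule comb_spanI[of "\<lambda>i. a i * y"])
        (use a y in \<open>auto simp: sum_distrib_right mult.assoc intro!: mult_mem\<close>)
  qed
  have sub: "comb_span C r J \<subseteq> C"
    using r by (auto simp: comb_span_def intro!: sum_mem mult_mem)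
  show "subgroup (comb_span C r J) (add_monoid R)"
  proof (rule R.add.subgroupI)
    show "comb_span C r J \<noteq> {}"
      using comb_spanI[of "\<lambda>_. 0" J C _ r] zero_mem by auto
    show "\<ominus>\<^bsub>R\<^esub> x \<in> comb_span C r J" if "x \<in> comb_span C r J" for x
      using mult[OF that uminus_mem[OF one_mem]] sub that by (subst a_inv_eq) auto
  qed (use sub add in \<open>auto simp: ring_eqs\<close>)
  show "y \<otimes>\<^bsub>R\<^esub> x \<in> comb_span C r J" if "x \<in> comb_span C r J" "y \<in> carrier R" for x y
    using mult[of x y] that by (simp add: ring_eqs mult.commute)
  show "x \<otimes>\<^bsub>R\<^esub> y \<in> comb_span C r J" if "x \<in> comb_span C r J" "y \<in> carrier R" for x y
    using mult[of x y] that by (simp add: ring_eqs)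
qed

lemma genideal_eq_comb_span:
  assumes "finite J" and r: "\<And>i. i \<in> J \<Longrightarrow> r i \<in> C"
  shows "Idl\<^bsub>R\<^esub> (r ` J) = comb_span C r J"
proof
  show "Idl\<^bsub>R\<^esub> (r ` J) \<subseteq> comb_span C r J"
    using comb_span_generator[OF assms(1), of _ r] by (intro R.genideal_minimal ideal_comb_span r) auto
  have J: "r ` J \<subseteq> carrier R" using r by (auto simp: carrier_eq)
  interpret I: ideal "Idl\<^bsub>R\<^esub> (r ` J)" R by (rule R.genideal_ideal[OF J])
  show "comb_span C r J \<subseteq> Idl\<^bsub>R\<^esub> (r ` J)"
  proof
    fix x assume "x \<in> comb_span C r J"
    then obtain c where c: "c \<in> J \<rightarrow> C" "x = (\<Sum>i\<in>J. r i * c i)" by (rule comb_spanE)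
    have "r i * c i \<in> Idl\<^bsub>R\<^esub> (r ` J)" if "i \<in> J" for i
      using I.I_r_closed[of "r i" "c i"] that c(1) R.genideal_self[OF J] by (auto simp: ring_eqs)
    then show "x \<in> Idl\<^bsub>R\<^esub> (r ` J)"
      unfolding c(2) by (rule ideal_sum[OF I.ideal_axioms])
  qed
qed

lemma coset_eq_ideal_iff:
  assumes "ideal I R" "a \<in> C"
  shows "I +>\<^bsub>R\<^esub> a = I \<longleftrightarrow> a \<in> I"
proof -
  interpret ideal I R by fact
  show ?thesis
    using a_rcos_self[of a] a_rcos_const[of a] assms(2) by (auto simp: carrier_eq)
qed

lemma carrier_quotE:
  assumes "x \<in> carrier (R Quot I)"
  obtains a where "a \<in> C" "x = I +>\<^bsub>R\<^esub> a"
  using assms by (auto simp: FactRing_def A_RCOSETS_def' carrier_eq)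

lemma coset_in_quot: "a \<in> C \<Longrightarrow> I +>\<^bsub>R\<^esub> a \<in> carrier (R Quot I)"
  by (auto simp: FactRing_def A_RCOSETS_def' carrier_eq)

lemma quot_mult:
  assumes "ideal I R" "a \<in> C" "b \<in> C"
  shows "(I +>\<^bsub>R\<^esub> a) \<otimes>\<^bsub>R Quot I\<^esub> (I +>\<^bsub>R\<^esub> b) = I +>\<^bsub>R\<^esub> (a * b)"
  using ideal.rcoset_mult_add[OF assms(1), of a b] assms(2,3) by (simp add: FactRing_def ring_eqs)

lemma quot_add:
  assumes "ideal I R" "a \<in> C" "b \<in> C"
  shows "(I +>\<^bsub>R\<^esub> a) \<oplus>\<^bsub>R Quot I\<^esub> (I +>\<^bsub>R\<^esub> b) = I +>\<^bsub>R\<^esub> (a + b)"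
proof -
  interpret ideal I R by fact
  show ?thesis using a_rcos_sum[of a b] assms(2,3) by (simp add: FactRing_def ring_eqs)
qed

lemma module_quotient:
  assumes "ideal I R"
  shows "module R (quotient_module R I)"
proof -
  interpret ideal I R by fact
  interpret Q: cring "R Quot I" by (rule quotient_is_cring[OF cring])
  show ?thesis
  proof (rule moduleI)
    show "abelian_group (quotient_module R I)"
    proof (rule abelian_groupI)
      fix x assume "x \<in> carrier (quotient_module R I)"
      then show "\<exists>y\<in>carrier (quotient_module R I).
          y \<oplus>\<^bsub>quotient_module R I\<^esub> x = \<zero>\<^bsub>quotient_module R I\<^esub>"
        by (intro bexI[of _ "\<ominus>\<^bsub>R Quot I\<^esub> x"]) (auto simp: quotient_module_def Q.l_neg)
    qed (simp_all add: quotient_module_def Q.a_ac)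
  qed (auto simp: quotient_module_def quot_mult[OF assms] quot_add[OF assms] ring_eqs cring
        coset_in_quot mult_mem add_mem one_mem algebra_simps elim!: carrier_quotE)
qed

text \<open>
  Regularity at each step is \<open>nonzerodivisor_modulo\<close> for an initial segment of the list.
\<close>

theorem regular_sequence_if_retracted:
  assumes "retracted_family C {..<length rs} ((!) rs) D"
    and proper: "Idl\<^bsub>R\<^esub> (set rs) \<noteq> carrier R"
  shows "regular_sequence R rs"
  unfolding regular_sequence_def Let_def
proof (intro conjI allI impI ballI)
  interpret D: retracted_family C "{..<length rs}" "(!) rs" D by fact
  show "set rs \<subseteq> carrier R"
    using D.r_mem by (auto simp: carrier_eq set_conv_nth)
  fix i x
  assume i: "i < length rs"
  define I where "I = Idl\<^bsub>R\<^esub> (set (take i rs))"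
  have "set (take i rs) = (!) rs ` {..<i}"
    using i nth_image[of i rs] by (simp add: atLeast0LessThan)
  then have I: "I = comb_span C ((!) rs) {..<i}"
    unfolding I_def by (simp only:) (rule genideal_eq_comb_span, use i D.r_mem in auto)
  have idl: "ideal I R"
    unfolding I using i by (intro ideal_comb_span D.r_mem) auto
  assume "x \<in> carrier (R Quot Idl\<^bsub>R\<^esub> (set (take i rs)))"
    and zero: "(Idl\<^bsub>R\<^esub> (set (take i rs)) +>\<^bsub>R\<^esub> rs ! i) \<otimes>\<^bsub>R Quot Idl\<^bsub>R\<^esub> (set (take i rs))\<^esub> x =
      \<zero>\<^bsub>R Quot Idl\<^bsub>R\<^esub> (set (take i rs))\<^esub>"
  then obtain a where a: "a \<in> C" "x = I +>\<^bsub>R\<^esub> a"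
    unfolding I_def[symmetric] by (elim carrier_quotE)
  have r: "rs ! i \<in> C" using i by (intro D.r_mem) simp
  have "I +>\<^bsub>R\<^esub> (rs ! i * a) = I"
    using zero[folded I_def] a quot_mult[OF idl r a(1)] by (simp add: FactRing_def)
  then have "rs ! i * a \<in> I"
    using coset_eq_ideal_iff[OF idl mult_mem[OF r a(1)]] by simp
  then have "a \<in> I"
    unfolding I by (rule D.nonzerodivisor_modulo[rotated 3]) (use i in auto)
  then show "x = \<zero>\<^bsub>R Quot Idl\<^bsub>R\<^esub> (set (take i rs))\<^esub>"
    using coset_eq_ideal_iff[OF idl a(1)] a(2) by (simp add: I_def FactRing_def)
qed (fact proper)

theorem inter_eq_ideal_prod_if_retracted:
  assumes "retracted_family C \<Lambda> r D" "J \<subseteq> \<Lambda>" "J' \<subseteq> \<Lambda>" "J \<inter> J' = {}"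
  shows "comb_span C r J \<inter> comb_span C r J' = ideal_prod R (comb_span C r J) (comb_span C r J')"
    (is "?I \<inter> ?I' = ?N")
proof
  interpret D: retracted_family C \<Lambda> r D by fact
  interpret I: ideal ?I R by (rule ideal_comb_span) (use D.r_mem assms(2) in auto)
  interpret I': ideal ?I' R by (rule ideal_comb_span) (use D.r_mem assms(3) in auto)
  have gen: "r i \<in> comb_span C r K" if "i \<in> K" "K \<subseteq> \<Lambda>" for i K
    using that D.finite_index by (intro comb_span_generator finite_subset[of K \<Lambda>])
  show "?N \<subseteq> ?I \<inter> ?I'"
    by (rule R.ideal_prod_inter[OF I.ideal_axioms I'.ideal_axioms])
  show "?I \<inter> ?I' \<subseteq> ?N"
  proof
    fix x assume "x \<in> ?I \<inter> ?I'"
    then have x: "x \<in> ?I" "x \<in> ?I'" by auto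
    show "x \<in> ?N"
    proof (rule D.intersection_induct[OF assms(2-4) x])
      have "\<zero>\<^bsub>R\<^esub> \<otimes>\<^bsub>R\<^esub> \<zero>\<^bsub>R\<^esub> \<in> ?N" by (intro ideal_prod.prod I.zero_closed I'.zero_closed)
      then show "0 \<in> ?N" by (simp add: ring_eqs)
      show "a + b \<in> ?N" if "a \<in> ?N" "b \<in> ?N" for a b
        using ideal_prod.sum[OF that] by (simp add: ring_eqs)
      fix i j c assume ij: "i \<in> J" "j \<in> J'" and "c \<in> C"
      then have "r i * c \<in> ?I"
        using I.I_r_closed[OF gen[OF ij(1) assms(2)], of c] by (simp add: ring_eqs)
      then have "(r i * c) \<otimes>\<^bsub>R\<^esub> r j \<in> ?N"
        by (rule ideal_prod.prod) (rule gen[OF ij(2) assms(3)])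
      then show "r i * c * r j \<in> ?N" by (simp add: ring_eqs)
    qed
  qed
qed

section \<open>Free modules and the Koszul resolution\<close>

lemma free_module_sel:
  "carrier (free_module R B) = B \<rightarrow>\<^sub>E C"
  "\<zero>\<^bsub>free_module R B\<^esub> = (\<lambda>b\<in>B. 0)"
  "f \<oplus>\<^bsub>free_module R B\<^esub> h = (\<lambda>b\<in>B. f b + h b)"
  "a \<odot>\<^bsub>free_module R B\<^esub> f = (\<lambda>b\<in>B. a * f b)"
  by (simp_all add: free_module_def ring_eqs)

lemma module_free: "module R (free_module R B)"
proof (rule moduleI)
  show "abelian_group (free_module R B)"
  proof (rule abelian_groupI)
    fix f assume f: "f \<in> carrier (free_module R B)"
    show "\<exists>h\<in>carrier (free_module R B). h \<oplus>\<^bsub>free_module R B\<^esub> f = \<zero>\<^bsub>free_module R B\<^esub>"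
      by (rule bexI[of _ "\<lambda>b\<in>B. - f b"])
        (use f in \<open>auto simp: free_module_sel intro!: uminus_mem ext\<close>)
  qed (auto simp: free_module_sel PiE_iff extensional_def fun_eq_iff restrict_def ac_simps
         intro!: add_mem zero_mem)
qed (auto simp: free_module_sel ring_eqs PiE_iff extensional_def fun_eq_iff restrict_def
       algebra_simps cring intro!: mult_mem)

lemma finsum_free_module:
  assumes "finite A" "\<And>a. a \<in> A \<Longrightarrow> F a \<in> carrier (free_module R B)"
  shows "finsum (free_module R B) F A = (\<lambda>b\<in>B. \<Sum>a\<in>A. F a b)"
  using assms
proof (induction A rule: finite_induct)
  interpret M: module R "free_module R B" by (rule module_free)
  case empty
  then show ?case by (simp add: free_module_sel)
next
  interpret M: module R "free_module R B" by (rule module_free)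
  case (insert x A)
  then show ?case
    by (subst M.finsum_insert) (auto simp: free_module_sel fun_eq_iff)
qed

definition unit_vec :: "'b set \<Rightarrow> 'b \<Rightarrow> 'b \<Rightarrow> 'a" where
  "unit_vec B b = (\<lambda>c\<in>B. if c = b then 1 else 0)"

lemma unit_vec_carrier: "unit_vec B b \<in> carrier (free_module R B)"
  by (auto simp: unit_vec_def free_module_sel one_mem zero_mem)

lemma free_module_expand:
  assumes "finite B" "c \<in> B \<rightarrow> C"
  shows "(\<Oplus>\<^bsub>free_module R B\<^esub>b\<in>B. c b \<odot>\<^bsub>free_module R B\<^esub> unit_vec B b) = (\<lambda>b\<in>B. c b)"
proof -
  interpret M: module R "free_module R B" by (rule module_free)
  have "(\<Oplus>\<^bsub>free_module R B\<^esub>b\<in>B. c b \<odot>\<^bsub>free_module R B\<^esub> unit_vec B b) =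
      (\<lambda>d\<in>B. \<Sum>b\<in>B. (c b \<odot>\<^bsub>free_module R B\<^esub> unit_vec B b) d)"
    using assms by (intro finsum_free_module M.smult_closed unit_vec_carrier) (auto simp: carrier_eq)
  also have "\<dots> = (\<lambda>d\<in>B. \<Sum>b\<in>B. if b = d then c b else 0)"
    by (intro restrict_ext sum.cong) (auto simp: free_module_sel unit_vec_def)
  also have "\<dots> = (\<lambda>b\<in>B. c b)"
    using assms(1) by (intro restrict_ext) simp
  finally show ?thesis .
qed

lemma finite_free_free_module:
  assumes "finite B"
  shows "finite_free R (free_module R B)"
  unfolding finite_free_def
proof (intro exI[of _ "unit_vec B ` B"] conjI ballI)
  interpret M: module R "free_module R B" by (rule module_free)
  have inj: "inj_on (unit_vec B) B"
  proof (rule inj_onI, rule ccontr)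
    fix a b assume ab: "a \<in> B" "b \<in> B" "unit_vec B a = unit_vec B b" "a \<noteq> b"
    have "unit_vec B a a = unit_vec B b a" using ab(3) by simp
    then show False using ab(1,4) by (simp add: unit_vec_def)
  qed
  have expand: "(\<Oplus>\<^bsub>free_module R B\<^esub>v\<in>unit_vec B ` B. c v \<odot>\<^bsub>free_module R B\<^esub> v) =
      (\<lambda>b\<in>B. c (unit_vec B b))" if "c \<in> unit_vec B ` B \<rightarrow>\<^sub>E C" for c
  proof (subst M.finsum_reindex)
    show "(\<lambda>v. c v \<odot>\<^bsub>free_module R B\<^esub> v) \<in> unit_vec B ` B \<rightarrow> carrier (free_module R B)"
      using that by (auto intro!: M.smult_closed unit_vec_carrier simp: carrier_eq)
    show "(\<Oplus>\<^bsub>free_module R B\<^esub>b\<in>B. c (unit_vec B b) \<odot>\<^bsub>free_module R B\<^esub> unit_vec B b) =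
      (\<lambda>b\<in>B. c (unit_vec B b))"
      using that by (intro free_module_expand assms) auto
  qed (rule inj)
  show "finite (unit_vec B ` B)" using assms by simp
  show "unit_vec B ` B \<subseteq> carrier (free_module R B)" using unit_vec_carrier by auto
  fix x assume x: "x \<in> carrier (free_module R B)"
  let ?c = "\<lambda>v\<in>unit_vec B ` B. x (inv_into B (unit_vec B) v)"
  \<comment> \<open>coefficients are indexed by the unit vectors themselves, hence the detour through the inverse of \<open>unit_vec B\<close>\<close>
  show "\<exists>!c. c \<in> unit_vec B ` B \<rightarrow>\<^sub>E carrier R \<and>
      x = (\<Oplus>\<^bsub>free_module R B\<^esub>v\<in>unit_vec B ` B. c v \<odot>\<^bsub>free_module R B\<^esub> v)"
  proof (rule ex1I[of _ ?c])
    have c: "?c \<in> unit_vec B ` B \<rightarrow>\<^sub>E C"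
      using x inj by (auto simp: free_module_sel PiE_iff inv_into_f_f)
    have "(\<lambda>b\<in>B. ?c (unit_vec B b)) = x"
      using x inj by (auto simp: free_module_sel PiE_iff extensional_def inv_into_f_f fun_eq_iff)
    then show "?c \<in> unit_vec B ` B \<rightarrow>\<^sub>E carrier R \<and>
      x = (\<Oplus>\<^bsub>free_module R B\<^esub>v\<in>unit_vec B ` B. ?c v \<odot>\<^bsub>free_module R B\<^esub> v)"
      using c expand[OF c] by (simp add: carrier_eq)
    fix c assume "c \<in> unit_vec B ` B \<rightarrow>\<^sub>E carrier R \<and>
      x = (\<Oplus>\<^bsub>free_module R B\<^esub>v\<in>unit_vec B ` B. c v \<odot>\<^bsub>free_module R B\<^esub> v)"
    then have d: "c \<in> unit_vec B ` B \<rightarrow>\<^sub>E C" "x = (\<lambda>b\<in>B. c (unit_vec B b))"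
      using expand[of c] by (auto simp: carrier_eq)
    show "c = ?c"
    proof (rule PiE_ext[OF d(1) c])
      fix v assume "v \<in> unit_vec B ` B"
      then show "c v = ?c v" using inj d(2) by (auto simp: inv_into_f_f)
    qed
  qed
qed

text \<open>
  Writing \<open>f\<close> in terms of the unit vectors exhibits it as a sum of elements of \<open>I\<close> times vectors.
\<close>

lemma mem_ideal_smult_free_module:
  assumes "finite B" "ideal I R" "f \<in> carrier (free_module R B)" "\<And>b. b \<in> B \<Longrightarrow> f b \<in> I"
  shows "f \<in> ideal_smult R I (free_module R B)"
  unfolding ideal_smult_def
proof (rule InterI, clarify)
  interpret M: module R "free_module R B" by (rule module_free)
  fix N assume N: "submodule N R (free_module R B)"
    and smult: "\<forall>a\<in>I. \<forall>x\<in>carrier (free_module R B). a \<odot>\<^bsub>free_module R B\<^esub> x \<in> N"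
  have mem: "f b \<odot>\<^bsub>free_module R B\<^esub> unit_vec B b \<in> N" if "b \<in> B" for b
    using bspec[OF bspec[OF smult assms(4)[OF that]] unit_vec_carrier] .
  have sub: "N \<subseteq> carrier (free_module R B)" using M.submoduleE(1)[OF N] .
  have zero: "\<zero>\<^bsub>free_module R B\<^esub> \<in> N"
    using subgroup.one_closed[OF submodule.axioms(1)[OF N]] by simp
  have "(\<Oplus>\<^bsub>free_module R B\<^esub>b\<in>A. f b \<odot>\<^bsub>free_module R B\<^esub> unit_vec B b) \<in> N" if "A \<subseteq> B" for A
    using finite_subset[OF that assms(1)] that
  proof (induction A rule: finite_induct)
    case empty
    then show ?case using zero by simp
  next
    case (insert b A)
    then show ?case
      using mem sub by (subst M.finsum_insert) (auto intro!: M.submoduleE(5)[OF N])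
  qed
  from this[OF subset_refl]
  have "(\<lambda>b\<in>B. f b) \<in> N"
    using assms(3) by (subst (asm) free_module_expand[OF assms(1)]) (auto simp: free_module_sel)
  moreover have "(\<lambda>b\<in>B. f b) = f"
    using assms(3) by (auto simp: free_module_sel PiE_iff extensional_def fun_eq_iff)
  ultimately show "f \<in> N" by simp
qed

lemma finite_psubsets: "finite (psubsets k p)"
  by (rule finite_subset[of _ "Pow {..<k}"]) (auto simp: psubsets_def)

lemma insert_psubsets: "T \<in> psubsets k p \<Longrightarrow> i \<in> {..<k} - T \<Longrightarrow> insert i T \<in> psubsets k (Suc p)"
  by (auto simp: psubsets_def card_insert_if finite_subset[of T "{..<k}"])

lemma koszul_diff_eq:
  assumes "set rs \<subseteq> C" "\<And>S. S \<in> psubsets (length rs) (Suc p) \<Longrightarrow> f S \<in> C"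
  shows "koszul_diff R rs p f = (\<lambda>T\<in>psubsets (length rs) p. koszul_coeff (length rs) ((!) rs) f T)"
  unfolding koszul_diff_def koszul_coeff_def
proof (intro restrict_ext)
  fix T assume T: "T \<in> psubsets (length rs) p"
  have "(- 1) ^ card {j \<in> T. j < i} * (rs ! i * f (insert i T)) \<in> C"
    if "i \<in> {..<length rs} - T" for i
    using that assms insert_psubsets[OF T that] nth_mem[of i rs] by (auto intro!: mult_mem sign_mem)
  then show "(\<Oplus>\<^bsub>R\<^esub>i\<in>{..<length rs} - T. (\<ominus>\<^bsub>R\<^esub> \<one>\<^bsub>R\<^esub>) [^]\<^bsub>R\<^esub> card {j \<in> T. j < i} \<otimes>\<^bsub>R\<^esub>
        (rs ! i \<otimes>\<^bsub>R\<^esub> f (insert i T))) =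
      (\<Sum>i\<in>{..<length rs} - T. (- 1) ^ card {j \<in> T. j < i} * (rs ! i * f (insert i T)))"
    by (subst finsum_eq) (auto simp: mult_eq sign_eq)
qed

lemma koszul_coeff_cong:
  assumes "\<And>S. S \<in> psubsets k (Suc p) \<Longrightarrow> f S = h S" "T \<in> psubsets k p"
  shows "koszul_coeff k r f T = koszul_coeff k r h T"
  unfolding koszul_coeff_def using assms insert_psubsets[OF assms(2)] by (intro sum.cong) auto

lemma koszul_coeff_mem:
  assumes "set rs \<subseteq> C" "\<And>S. S \<in> psubsets (length rs) (Suc p) \<Longrightarrow> f S \<in> C" "T \<in> psubsets (length rs) p"
  shows "koszul_coeff (length rs) ((!) rs) f T \<in> C"
  unfolding koszul_coeff_def using assms(1) insert_psubsets[OF assms(3)]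
  by (intro sum_mem mult_mem sign_mem assms(2)) (auto simp: set_conv_nth)

lemma koszul_diff_hom:
  assumes rs: "set rs \<subseteq> C"
  shows "koszul_diff R rs p \<in> module_homs R (koszul_module R rs (Suc p)) (koszul_module R rs p)"
  unfolding module_homs_def koszul_module_def
proof (intro CollectI conjI ballI funcsetI)
  let ?k = "length rs"
  fix f assume "f \<in> carrier (free_module R (psubsets ?k (Suc p)))"
  then have f: "f S \<in> C" if "S \<in> psubsets ?k (Suc p)" for S
    using that by (auto simp: free_module_sel)
  show "koszul_diff R rs p f \<in> carrier (free_module R (psubsets ?k p))"
    using koszul_coeff_mem[OF rs f] by (auto simp: koszul_diff_eq[OF rs f] free_module_sel)
  {
    fix h assume "h \<in> carrier (free_module R (psubsets ?k (Suc p)))"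
    then have h: "h S \<in> C" if "S \<in> psubsets ?k (Suc p)" for S
      using that by (auto simp: free_module_sel)
    have "koszul_coeff ?k ((!) rs) (\<lambda>S\<in>psubsets ?k (Suc p). f S + h S) T =
      koszul_coeff ?k ((!) rs) f T + koszul_coeff ?k ((!) rs) h T" if "T \<in> psubsets ?k p" for T
      unfolding koszul_coeff_add[symmetric] using that by (intro koszul_coeff_cong) auto
    then show "koszul_diff R rs p (f \<oplus>\<^bsub>free_module R (psubsets ?k (Suc p))\<^esub> h) =
        koszul_diff R rs p f \<oplus>\<^bsub>free_module R (psubsets ?k p)\<^esub> koszul_diff R rs p h"
      using f h by (simp add: koszul_diff_eq[OF rs] free_module_sel add_mem cong: restrict_cong)
  }
next
  let ?k = "length rs"
  fix a f assume "f \<in> carrier (free_module R (psubsets ?k (Suc p)))" and "a \<in> carrier R"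
  then have f: "f S \<in> C" if "S \<in> psubsets ?k (Suc p)" for S
    using that by (auto simp: free_module_sel)
  have a: "a \<in> C" using \<open>a \<in> carrier R\<close> by (simp add: carrier_eq)
  have "koszul_coeff ?k ((!) rs) (\<lambda>S\<in>psubsets ?k (Suc p). a * f S) T =
    koszul_coeff ?k ((!) rs) (\<lambda>S. a * f S) T" if "T \<in> psubsets ?k p" for T
    using that by (intro koszul_coeff_cong) auto
  also have "koszul_coeff ?k ((!) rs) (\<lambda>S. a * f S) T = a * koszul_coeff ?k ((!) rs) f T" for T
    by (simp add: koszul_coeff_def sum_distrib_left ac_simps)
  finally show "koszul_diff R rs p (a \<odot>\<^bsub>free_module R (psubsets ?k (Suc p))\<^esub> f) =
      a \<odot>\<^bsub>free_module R (psubsets ?k p)\<^esub> koszul_diff R rs p f"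
    using f a by (simp add: koszul_diff_eq[OF rs] free_module_sel mult_mem cong: restrict_cong)
qed

text \<open>
  Exactness in positive degrees is \<open>koszul_exact\<close>, once a cycle of degree \<open>p + 1\<close> is extended by zero
  to sets of all cardinalities. In degree zero the image of the differential is the ideal generated by
  the list, which is the kernel of the augmentation.
\<close>

theorem koszul_resolution_if_retracted:
  assumes "retracted_family C {..<length rs} ((!) rs) D"
    and I: "I = Idl\<^bsub>R\<^esub> (set rs)"
    and \<mm>: "ideal \<mm> R" "set rs \<subseteq> \<mm>"
  shows "minimal_free_resolution R \<mm> (koszul_module R rs) (koszul_diff R rs) (koszul_aug R I)
    (quotient_module R I)"
proof -
  let ?k = "length rs" and ?d = "koszul_diff R rs" and ?K = "koszul_module R rs"
  interpret D: retracted_list C ?k "(!) rs" D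
    using assms(1) by (simp add: retracted_list_def)
  have rs: "set rs \<subseteq> C" using D.r_mem by (auto simp: set_conv_nth)
  have idl: "ideal I R" unfolding I using rs by (intro R.genideal_ideal) (simp add: carrier_eq)
  have set_rs: "set rs = (!) rs ` {..<?k}" by (auto simp: set_conv_nth)
  have I_span: "I = comb_span C ((!) rs) {..<?k}"
    unfolding I set_rs by (intro genideal_eq_comb_span D.r_mem) auto
  have hom: "?d p \<in> module_homs R (?K (Suc p)) (?K p)" for p
    by (rule koszul_diff_hom[OF rs])
  have carr: "f \<in> carrier (?K p) \<longleftrightarrow> f \<in> psubsets ?k p \<rightarrow>\<^sub>E C" for f p
    by (simp add: koszul_module_def free_module_sel)
  have zero: "\<zero>\<^bsub>?K p\<^esub> = (\<lambda>T\<in>psubsets ?k p. 0)" for p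
    by (simp add: koszul_module_def free_module_sel)
  have d_eq: "?d p f = (\<lambda>T\<in>psubsets ?k p. koszul_coeff ?k ((!) rs) f T)"
    if "f \<in> carrier (?K (Suc p))" for f p
    using that by (intro koszul_diff_eq[OF rs]) (auto simp: carr)
  have empty: "psubsets ?k 0 = {{}}"
    by (auto simp: psubsets_def finite_subset[of _ "{..<length rs}"])
  have fin: "finite T" if "T \<in> psubsets ?k p" for T p
    using that by (auto simp: psubsets_def intro: finite_subset)
  have aug: "koszul_aug R I \<in> module_homs R (?K 0) (quotient_module R I)"
    unfolding module_homs_def
  proof (intro CollectI conjI ballI funcsetI)
    fix f assume "f \<in> carrier (?K 0)"
    then have f: "f {} \<in> C" by (auto simp: carr empty)
    then show "koszul_aug R I f \<in> carrier (quotient_module R I)"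
      by (simp add: koszul_aug_def quotient_module_def coset_in_quot)
    fix h assume "h \<in> carrier (?K 0)"
    then have "h {} \<in> C" by (auto simp: carr empty)
    then show "koszul_aug R I (f \<oplus>\<^bsub>?K 0\<^esub> h) =
        koszul_aug R I f \<oplus>\<^bsub>quotient_module R I\<^esub> koszul_aug R I h"
      using quot_add[OF idl f]
      by (simp add: koszul_aug_def quotient_module_def koszul_module_def free_module_sel empty)
  next
    fix a f assume "a \<in> carrier R" "f \<in> carrier (?K 0)"
    then have "a \<in> C" "f {} \<in> C" by (auto simp: carr empty carrier_eq)
    then show "koszul_aug R I (a \<odot>\<^bsub>?K 0\<^esub> f) = a \<odot>\<^bsub>quotient_module R I\<^esub> koszul_aug R I f"
      using quot_mult[OF idl]
      by (simp add: koszul_aug_def quotient_module_def koszul_module_def free_module_sel empty)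
  qed
  have aug_surj: "koszul_aug R I ` carrier (?K 0) = carrier (quotient_module R I)"
  proof
    show "koszul_aug R I ` carrier (?K 0) \<subseteq> carrier (quotient_module R I)"
      using aug by (auto simp: module_homs_def)
    show "carrier (quotient_module R I) \<subseteq> koszul_aug R I ` carrier (?K 0)"
    proof
      fix x assume "x \<in> carrier (quotient_module R I)"
      then obtain a where a: "a \<in> C" "x = I +>\<^bsub>R\<^esub> a"
        by (auto simp: quotient_module_def elim: carrier_quotE)
      then show "x \<in> koszul_aug R I ` carrier (?K 0)"
        by (intro image_eqI[of _ _ "\<lambda>T\<in>{{}}. a"]) (auto simp: koszul_aug_def carr empty)
    qed
  qed
  have aug_kernel: "a_kernel (?K 0) (quotient_module R I) (koszul_aug R I) = ?d 0 ` carrier (?K 1)"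
  proof
    show "a_kernel (?K 0) (quotient_module R I) (koszul_aug R I) \<subseteq> ?d 0 ` carrier (?K 1)"
    proof
      fix f assume "f \<in> a_kernel (?K 0) (quotient_module R I) (koszul_aug R I)"
      then have f: "f \<in> {{}} \<rightarrow>\<^sub>E C" "I +>\<^bsub>R\<^esub> f {} = I"
        by (auto simp: a_kernel_def' carr empty koszul_aug_def quotient_module_def FactRing_def)
      then have "f {} \<in> I" using coset_eq_ideal_iff[OF idl, of "f {}"] by auto
      then obtain c where c: "c \<in> {..<?k} \<rightarrow> C" "f {} = (\<Sum>i<?k. rs ! i * c i)"
        unfolding I_span by (rule comb_spanE)
      \<comment> \<open>the coefficient \<open>c i\<close> belongs to the basis vector indexed by \<open>{i}\<close>\<close>
      let ?h = "\<lambda>S\<in>psubsets ?k 1. c (the_elem S)"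
      have h: "?h \<in> carrier (?K 1)"
        using c(1) by (auto simp: carr psubsets_def card_1_singleton_iff)
      have "f T = ?d 0 ?h T" for T
      proof (cases "T = {}")
        case True
        have "{i} \<in> psubsets ?k 1" if "i < ?k" for i
          using that by (simp add: psubsets_def)
        then show ?thesis
          using True c(2) h by (simp add: d_eq empty koszul_coeff_def)
      next
        case False
        then show ?thesis
          using f(1) h by (auto simp: d_eq empty PiE_iff extensional_def)
      qed
      then show "f \<in> ?d 0 ` carrier (?K 1)" using h by blast
    qed
    show "?d 0 ` carrier (?K 1) \<subseteq> a_kernel (?K 0) (quotient_module R I) (koszul_aug R I)"
    proof
      fix f assume "f \<in> ?d 0 ` carrier (?K 1)"
      then obtain h where h: "h \<in> carrier (?K 1)" "f = ?d 0 h" by auto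
      have hc: "h {i} \<in> C" if "i < ?k" for i
        using h(1) that by (auto simp: carr psubsets_def)
      have f0: "f {} = (\<Sum>i<?k. rs ! i * h {i})"
        using h by (simp add: d_eq empty koszul_coeff_def)
      have "f {} \<in> I"
        unfolding I_span using hc by (intro comb_spanI[OF _ f0]) auto
      moreover have "f \<in> carrier (?K 0)"
        using hom[of 0] h by (auto simp: module_homs_def)
      ultimately show "f \<in> a_kernel (?K 0) (quotient_module R I) (koszul_aug R I)"
        using coset_eq_ideal_iff[OF idl, of "f {}"]
        by (auto simp: a_kernel_def' koszul_aug_def quotient_module_def FactRing_def carr empty)
    qed
  qed
  have exact: "a_kernel (?K (Suc p)) (?K p) (?d p) = ?d (Suc p) ` carrier (?K (Suc (Suc p)))" for p
  proof
    show "a_kernel (?K (Suc p)) (?K p) (?d p) \<subseteq> ?d (Suc p) ` carrier (?K (Suc (Suc p)))"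
    proof
      fix f assume "f \<in> a_kernel (?K (Suc p)) (?K p) (?d p)"
      then have f: "f \<in> carrier (?K (Suc p))" "?d p f = \<zero>\<^bsub>?K p\<^esub>"
        by (auto simp: a_kernel_def')
      \<comment> \<open>\<open>koszul_exact\<close> ignores degrees, so \<open>f\<close> is continued by zero to all sets\<close>
      define f' where "f' S = (if S \<in> psubsets ?k (Suc p) then f S else 0)" for S
      have f': "f' S \<in> C" for S
        using f(1) by (auto simp: f'_def carr zero_mem)
      have cycle: "koszul_coeff ?k ((!) rs) f' T = 0" if T: "T \<subseteq> {..<?k}" for T
      proof (cases "T \<in> psubsets ?k p")
        case True
        then have "koszul_coeff ?k ((!) rs) f' T = ?d p f T"
          using f(1) by (auto simp: d_eq f'_def intro!: koszul_coeff_cong)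
        then show ?thesis using f(2) True by (simp add: zero)
      next
        case False
        then have "insert i T \<notin> psubsets ?k (Suc p)" if "i \<in> {..<?k} - T" for i
          using that T finite_subset[OF T] by (auto simp: psubsets_def)
        then show ?thesis by (simp add: koszul_coeff_def f'_def)
      qed
      obtain h where h: "\<And>S. S \<subseteq> {..<?k} \<Longrightarrow> h S \<in> C"
        "\<And>S. S \<subseteq> {..<?k} \<Longrightarrow> S \<noteq> {} \<Longrightarrow> f' S = koszul_coeff ?k ((!) rs) h S"
        using D.koszul_exact[of f'] f' cycle by blast
      let ?h = "restrict h (psubsets ?k (Suc (Suc p)))"
      have h': "?h \<in> carrier (?K (Suc (Suc p)))"
        using h(1) by (auto simp: carr psubsets_def)
      have "f S = ?d (Suc p) ?h S" for S
      proof (cases "S \<in> psubsets ?k (Suc p)")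
        case True
        then have "S \<subseteq> {..<?k}" "S \<noteq> {}" by (auto simp: psubsets_def)
        then have "f S = koszul_coeff ?k ((!) rs) h S"
          using h(2)[of S] True by (simp add: f'_def)
        also have "\<dots> = koszul_coeff ?k ((!) rs) ?h S"
          using True by (intro koszul_coeff_cong) auto
        finally show ?thesis using True h' by (simp add: d_eq)
      next
        case False
        then show ?thesis using f(1) h' by (auto simp: d_eq carr PiE_iff extensional_def)
      qed
      then show "f \<in> ?d (Suc p) ` carrier (?K (Suc (Suc p)))" using h' by blast
    qed
    show "?d (Suc p) ` carrier (?K (Suc (Suc p))) \<subseteq> a_kernel (?K (Suc p)) (?K p) (?d p)"
    proof
      fix f assume "f \<in> ?d (Suc p) ` carrier (?K (Suc (Suc p)))"
      then obtain h where h: "h \<in> carrier (?K (Suc (Suc p)))" "f = ?d (Suc p) h" by auto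
      have f: "f \<in> carrier (?K (Suc p))"
        using hom[of "Suc p"] h by (auto simp: module_homs_def)
      have "koszul_coeff ?k ((!) rs) f T = 0" if T: "T \<in> psubsets ?k p" for T
      proof -
        have "koszul_coeff ?k ((!) rs) f T =
            koszul_coeff ?k ((!) rs) (koszul_coeff ?k ((!) rs) h) T"
          using h T by (intro koszul_coeff_cong) (auto simp: d_eq)
        then show ?thesis using koszul_coeff_koszul_coeff[OF fin[OF T]] by simp
      qed
      then have "?d p f = \<zero>\<^bsub>?K p\<^esub>"
        using f by (auto simp: d_eq zero fun_eq_iff)
      then show "f \<in> a_kernel (?K (Suc p)) (?K p) (?d p)"
        using f by (simp add: a_kernel_def')
    qed
  qed
  have minimal: "?d p ` carrier (?K (Suc p)) \<subseteq> ideal_smult R \<mm> (?K p)" for p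
  proof
    interpret \<mm>: ideal \<mm> R by fact
    fix f assume "f \<in> ?d p ` carrier (?K (Suc p))"
    then obtain h where h: "h \<in> carrier (?K (Suc p))" "f = ?d p h" by auto
    have "f T \<in> \<mm>" if T: "T \<in> psubsets ?k p" for T
    proof -
      have "(- 1) ^ n * (rs ! i * h (insert i T)) \<in> \<mm>" if i: "i \<in> {..<?k} - T" for i n
      proof -
        have "(- 1) ^ n * h (insert i T) \<in> C"
          using insert_psubsets[OF T i] h(1) by (auto simp: carr intro!: mult_mem sign_mem)
        moreover have "rs ! i \<in> \<mm>" using i \<mm>(2) by auto
        ultimately show ?thesis
          using \<mm>.I_r_closed[of "rs ! i" "(- 1) ^ n * h (insert i T)"]
          by (simp add: ring_eqs mult.left_commute)
      qed
      then show ?thesis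
        using h T by (auto simp: d_eq koszul_coeff_def intro!: ideal_sum[OF \<mm>(1)])
    qed
    moreover have "f \<in> carrier (?K p)"
      using hom[of p] h by (auto simp: module_homs_def)
    ultimately show "f \<in> ideal_smult R \<mm> (?K p)"
      unfolding koszul_module_def by (intro mem_ideal_smult_free_module finite_psubsets \<mm>(1))
  qed
  have free: "module R (?K p)" "finite_free R (?K p)" for p
    unfolding koszul_module_def by (intro module_free finite_free_free_module finite_psubsets)+
  show ?thesis
    unfolding minimal_free_resolution_def free_resolution_def
    by (intro conjI allI module_quotient[OF idl] free hom aug aug_surj aug_kernel exact minimal)
qed

end

section \<open>Perturbing monomials by terms of lower weight\<close>

definition polys_in :: "'v set \<Rightarrow> ('v, 'k::field) mpoly set" where
  "polys_in V = {p. \<forall>\<mu>\<in>Poly_Mapping.keys p. Poly_Mapping.keys \<mu> \<subseteq> V}"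

lemma keys_add_nat:
  fixes \<mu> \<nu> :: "'v \<Rightarrow>\<^sub>0 nat"
  shows "Poly_Mapping.keys (\<mu> + \<nu>) = Poly_Mapping.keys \<mu> \<union> Poly_Mapping.keys \<nu>"
  by (auto simp: in_keys_iff lookup_add)

lemma keys_uminus: "Poly_Mapping.keys (- p :: 'a \<Rightarrow>\<^sub>0 'b::ab_group_add) = Poly_Mapping.keys p"
  by (auto simp: in_keys_iff)

lemma polys_in_subring: "unital_subring (polys_in V :: ('v, 'k::field) mpoly set)"
proof
  fix p q :: "('v, 'k) mpoly"
  assume p: "p \<in> polys_in V" and q: "q \<in> polys_in V"
  show "p + q \<in> polys_in V" using p q keys_add[of p q] by (auto simp: polys_in_def)
  show "p * q \<in> polys_in V"
    using p q keys_mult[of p q] by (fastforce simp: polys_in_def keys_add_nat)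
next
  show "- p \<in> polys_in V" if "p \<in> polys_in V" for p :: "('v, 'k) mpoly"
    using that by (auto simp: polys_in_def keys_uminus)
qed (auto simp: polys_in_def)

lemma explicit_ring_mpoly_ring: "explicit_ring (polys_in V) (mpoly_ring V :: ('v, 'k::field) mpoly ring)"
  by (intro explicit_ring.intro polys_in_subring explicit_ring_axioms.intro)
    (simp_all add: mpoly_ring_def polys_in_def)

lemma single_in_polys_in: "Poly_Mapping.keys \<mu> \<subseteq> V \<Longrightarrow> Poly_Mapping.single \<mu> c \<in> polys_in V"
  by (auto simp: polys_in_def)

lemma poly_mapping_additive_induct [case_names zero single add]:
  assumes "Q 0" and single: "\<And>a b. Q (Poly_Mapping.single a b)"
    and add: "\<And>p q. Q p \<Longrightarrow> Q q \<Longrightarrow> Q (p + q)"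
  shows "Q (p :: 'a \<Rightarrow>\<^sub>0 'b::comm_monoid_add)"
proof (induction p rule: update_induct)
  case (update f a b)
  have "Poly_Mapping.update a b f = f + Poly_Mapping.single a b"
    using update.hyps(1)
    by (intro poly_mapping_eqI) (auto simp: lookup_update lookup_add lookup_single in_keys_iff)
  then show ?case using add[OF update.IH single] by simp
qed fact

definition linear_extension ::
    "('a \<Rightarrow> ('v, 'k::field) mpoly) \<Rightarrow> ('a \<Rightarrow>\<^sub>0 'k) \<Rightarrow> ('v, 'k) mpoly" where
  "linear_extension B p =
     (\<Sum>\<mu>\<in>Poly_Mapping.keys p. Poly_Mapping.single 0 (Poly_Mapping.lookup p \<mu>) * B \<mu>)"

lemma linear_extension_superset:
  assumes "finite A" "Poly_Mapping.keys p \<subseteq> A"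
  shows "linear_extension B p = (\<Sum>\<mu>\<in>A. Poly_Mapping.single 0 (Poly_Mapping.lookup p \<mu>) * B \<mu>)"
  unfolding linear_extension_def using assms
  by (intro sum.mono_neutral_left) (auto simp: in_keys_iff)

lemma linear_extension_zero: "linear_extension B 0 = 0"
  by (simp add: linear_extension_def)

lemma linear_extension_single:
  "linear_extension B (Poly_Mapping.single \<mu> c) = Poly_Mapping.single 0 c * B \<mu>"
  by (subst linear_extension_superset[of "{\<mu>}"]) auto

lemma linear_extension_add: "linear_extension B (p + q) = linear_extension B p + linear_extension B q"
proof -
  let ?A = "Poly_Mapping.keys p \<union> Poly_Mapping.keys q"
  have "linear_extension B r = (\<Sum>\<mu>\<in>?A. Poly_Mapping.single 0 (Poly_Mapping.lookup r \<mu>) * B \<mu>)"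
    if "Poly_Mapping.keys r \<subseteq> ?A" for r
    using that by (intro linear_extension_superset) auto
  from this[of p] this[of q] this[of "p + q"] show ?thesis
    using keys_add[of p q] by (simp add: lookup_add single_add distrib_right sum.distrib)
qed

lemma linear_extension_diff: "linear_extension B (p - q) = linear_extension B p - linear_extension B q"
  using linear_extension_add[of B "p - q" q] by simp

text \<open>
  If \<open>B\<close> intertwines the shift by \<open>u\<close> with multiplication by \<open>f\<close>, then so does its linear extension;
  this is how multiplication by a leading monomial becomes multiplication by the polynomial itself.
\<close>

lemma linear_extension_mult:
  fixes u :: "'a::comm_monoid_add"
  assumes "\<And>\<mu>. B (\<mu> + u) = f * B \<mu>"
  shows "linear_extension B (Poly_Mapping.single u 1 * p) = f * linear_extension B p"
proof (induction p rule: poly_mapping_additive_induct)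
  case (single \<mu> c)
  then show ?case
    using assms[of \<mu>] by (simp add: mult_single linear_extension_single add.commute[of u] mult.left_commute)
qed (simp_all add: linear_extension_zero linear_extension_add distrib_left)

locale graded_monomials =
  fixes deg :: "('v \<Rightarrow>\<^sub>0 nat) \<Rightarrow> nat"
  assumes deg_add: "deg (\<mu> + \<nu>) = deg \<mu> + deg \<nu>"
begin

definition below :: "nat \<Rightarrow> ('v, 'k::field) mpoly \<Rightarrow> bool" where
  "below d p \<longleftrightarrow> (\<forall>\<mu>\<in>Poly_Mapping.keys p. deg \<mu> < d)"

text \<open>
  The monomial \<open>\<mu>\<close> with coefficient one is the part of \<open>p\<close> of degree at least \<open>deg \<mu>\<close>. Many
  monomials may share a degree, so this is stronger than \<open>\<mu>\<close> being one of the terms of largest degree.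
\<close>

definition leads :: "('v \<Rightarrow>\<^sub>0 nat) \<Rightarrow> ('v, 'k::field) mpoly \<Rightarrow> bool" where
  "leads \<mu> p \<longleftrightarrow> below (deg \<mu>) (p - Poly_Mapping.single \<mu> 1)"

lemma below_add: "below d p \<Longrightarrow> below d q \<Longrightarrow> below d (p + q)"
  using keys_add[of p q] by (auto simp: below_def)

lemma below_zero: "below d 0"
  by (simp add: below_def)

lemma below_sum: "(\<And>a. a \<in> A \<Longrightarrow> below d (h a)) \<Longrightarrow> below d (\<Sum>a\<in>A. h a)"
  by (induction A rule: infinite_finite_induct) (auto simp: below_add below_zero)

lemma below_uminus: "below d p \<Longrightarrow> below d (- p)"
  by (simp add: below_def keys_uminus)

lemma below_mult: "below (Suc d) p \<Longrightarrow> below e q \<Longrightarrow> below (d + e) (p * q)"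
  using keys_mult[of p q] by (fastforce simp: below_def deg_add)

lemma below_mono: "below d p \<Longrightarrow> d \<le> e \<Longrightarrow> below e p"
  by (auto simp: below_def)

lemma below_single: "below (Suc (deg \<mu>)) (Poly_Mapping.single \<mu> c)"
  by (auto simp: below_def)

lemma leads_single: "leads \<mu> (Poly_Mapping.single \<mu> 1)"
  by (simp add: leads_def below_def)

lemma leads_mult:
  assumes "leads \<mu> p" "leads \<nu> q"
  shows "leads (\<mu> + \<nu>) (p * q)"
proof -
  let ?s = "\<lambda>\<mu>. Poly_Mapping.single \<mu> 1 :: ('v, 'a) mpoly"
  have q: "below (Suc (deg \<nu>)) q"
    using below_add[OF below_mono[of "deg \<nu>" "q - ?s \<nu>" "Suc (deg \<nu>)"] below_single[of \<nu> 1]] assms(2)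
    by (simp add: leads_def)
  have "p * q - ?s (\<mu> + \<nu>) = q * (p - ?s \<mu>) + ?s \<mu> * (q - ?s \<nu>)"
    by (simp add: algebra_simps mult_single)
  moreover have "below (deg (\<mu> + \<nu>)) (q * (p - ?s \<mu>))"
    using below_mult[OF q, of "deg \<mu>" "p - ?s \<mu>"] assms(1) by (simp add: leads_def deg_add add.commute)
  moreover have "below (deg (\<mu> + \<nu>)) (?s \<mu> * (q - ?s \<nu>))"
    using below_mult[OF below_single[of \<mu> 1], of "deg \<nu>" "q - ?s \<nu>"] assms(2)
    by (simp add: leads_def deg_add)
  ultimately show ?thesis by (simp add: leads_def below_add)
qed

lemma leads_one: "leads 0 1"
  using leads_single[of 0] by simp

lemma leads_power: "leads \<mu> p \<Longrightarrow> leads (\<Sum>_<n. \<mu>) (p ^ n)"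
  by (induction n) (auto simp: leads_one leads_mult add.commute)

lemma leads_prod:
  "finite A \<Longrightarrow> (\<And>a. a \<in> A \<Longrightarrow> leads (\<mu> a) (p a)) \<Longrightarrow> leads (\<Sum>a\<in>A. \<mu> a) (\<Prod>a\<in>A. p a)"
  by (induction A rule: finite_induct) (auto simp: leads_one leads_mult)

end

text \<open>
  A family that agrees with the monomials up to terms of lower degree is again a basis. There can be
  infinitely many monomials of a given degree, but no triangular system has to be solved: the linear
  extension of \<open>B\<close> differs from the identity by a map that lowers the degree.
\<close>

locale unitriangular_basis = graded_monomials deg
  for deg :: "('v \<Rightarrow>\<^sub>0 nat) \<Rightarrow> nat" +
  fixes B :: "('v \<Rightarrow>\<^sub>0 nat) \<Rightarrow> ('v, 'k::field) mpoly"
  assumes B_leads: "leads \<mu> (B \<mu>)"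
begin

lemma linear_extension_close:
  assumes "below (Suc d) p"
  shows "below d (p - linear_extension B p)"
proof -
  let ?c = "\<lambda>\<mu>. Poly_Mapping.single 0 (Poly_Mapping.lookup p \<mu>) :: ('v, 'k) mpoly"
  have deg0: "deg 0 = 0" using deg_add[of 0 0] by simp
  have "p = linear_extension (\<lambda>\<mu>. Poly_Mapping.single \<mu> 1) p"
    by (induction p rule: poly_mapping_additive_induct)
      (simp_all add: linear_extension_zero linear_extension_add linear_extension_single mult_single)
  then have "p - linear_extension B p =
      (\<Sum>\<mu>\<in>Poly_Mapping.keys p. - (?c \<mu> * (B \<mu> - Poly_Mapping.single \<mu> 1)))"
    by (simp add: linear_extension_def right_diff_distrib sum_subtractf sum_negf)
  also have "below d \<dots>"
  proof (intro below_sum below_uminus)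
    fix \<mu> assume "\<mu> \<in> Poly_Mapping.keys p"
    then have "deg \<mu> \<le> d" using assms by (auto simp: below_def)
    moreover have "below (deg \<mu>) (?c \<mu> * (B \<mu> - Poly_Mapping.single \<mu> 1))"
      using below_mult[OF below_single[of 0], of "deg \<mu>"] B_leads[of \<mu>] by (simp add: leads_def deg0)
    ultimately show "below d (?c \<mu> * (B \<mu> - Poly_Mapping.single \<mu> 1))"
      by (rule below_mono[rotated])
  qed
  finally show ?thesis .
qed

lemma ex_below: "\<exists>d. below d p"
  by (rule exI[of _ "Suc (\<Sum>\<mu>\<in>Poly_Mapping.keys p. deg \<mu>)"])
    (auto simp: below_def less_Suc_eq_le intro: member_le_sum)

text \<open>
  An element of the kernel equals its own correction term, so the bound on its degree can be lowered
  until it is zero.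
\<close>

lemma linear_extension_inj: "inj (linear_extension B)"
proof (rule injI)
  fix x y assume "linear_extension B x = linear_extension B y"
  then have zero: "linear_extension B (x - y) = 0" by (simp add: linear_extension_diff)
  have "x - y = 0" if "below d (x - y)" for d
    using that
  proof (induction d)
    case 0
    then have "Poly_Mapping.keys (x - y) = {}" by (auto simp: below_def)
    then show ?case by simp
  next
    case (Suc d)
    then show ?case using linear_extension_close[OF Suc.prems] zero by simp
  qed
  then show "x = y" using ex_below[of "x - y"] by auto
qed

text \<open>
  A preimage of \<open>p\<close> is \<open>p\<close> plus a preimage of the correction \<open>p - linear_extension B p\<close>, which has
  lower degree. The restriction to variables in \<open>V\<close> makes the inverse map preserve the polynomials
  in these variables.
\<close>

lemma linear_extension_surj:
  assumes B: "\<And>\<mu>. Poly_Mapping.keys \<mu> \<subseteq> V \<Longrightarrow> B \<mu> \<in> polys_in V" and p: "p \<in> polys_in V"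
  shows "\<exists>q\<in>polys_in V. linear_extension B q = p"
proof -
  interpret unital_subring "polys_in V :: ('v, 'k) mpoly set" by (rule polys_in_subring)
  have ext: "linear_extension B q \<in> polys_in V" if "q \<in> polys_in V" for q
    using that unfolding linear_extension_def
    by (intro sum_mem mult_mem B single_in_polys_in) (auto simp: polys_in_def)
  have "\<exists>q\<in>polys_in V. linear_extension B q = p" if "below d p" "p \<in> polys_in V" for d p
    using that
  proof (induction d arbitrary: p)
    case 0
    then have "Poly_Mapping.keys p = {}" by (auto simp: below_def)
    then have "p = 0" by simp
    then show ?case using zero_mem linear_extension_zero by blast
  next
    case (Suc d)
    obtain q where q: "q \<in> polys_in V" "linear_extension B q = p - linear_extension B p"
      using Suc.IH[OF linear_extension_close[OF Suc.prems(1)]] Suc.prems(2) ext by (blast intro: diff_mem)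
    then show ?case
      using Suc.prems(2) by (intro bexI[of _ "p + q"]) (auto simp: linear_extension_add intro: add_mem)
  qed
  then show ?thesis using ex_below p by blast
qed

end

section \<open>Polynomials with pairwise coprime leading monomials\<close>

text \<open>
  Division by the monomial \<open>u\<close>; monomials that are not divisible by \<open>u\<close> go to zero.
\<close>

definition divide_monomial :: "('v \<Rightarrow>\<^sub>0 nat) \<Rightarrow> ('v, 'k::field) mpoly \<Rightarrow> ('v, 'k) mpoly" where
  "divide_monomial u = Poly_Mapping.map_key (\<lambda>\<mu>. \<mu> + u)"

lemma inj_add_monomial: "inj (\<lambda>\<mu>. \<mu> + u :: 'v \<Rightarrow>\<^sub>0 nat)"
  by (simp add: inj_def)

lemma keys_divide_monomial: "Poly_Mapping.keys (divide_monomial u p) = {\<mu>. \<mu> + u \<in> Poly_Mapping.keys p}"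
  by (auto simp: divide_monomial_def keys_map_key[OF inj_add_monomial])

lemma divide_monomial_add: "divide_monomial u (p + q) = divide_monomial u p + divide_monomial u q"
  by (simp add: divide_monomial_def map_key_plus[OF inj_add_monomial])

lemma divide_monomial_zero: "divide_monomial u 0 = 0"
  by (simp add: divide_monomial_def map_key_zero[OF inj_add_monomial])

lemma divide_monomial_single: "divide_monomial u (Poly_Mapping.single (\<mu> + u) c) = Poly_Mapping.single \<mu> c"
  unfolding divide_monomial_def by (rule map_key_single[OF inj_add_monomial])

lemma divide_monomial_single_0:
  assumes "\<And>\<nu>. \<mu> \<noteq> \<nu> + u"
  shows "divide_monomial u (Poly_Mapping.single \<mu> c) = 0"
proof -
  have "Poly_Mapping.keys (divide_monomial u (Poly_Mapping.single \<mu> c)) = {}"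
    using assms by (auto simp: keys_divide_monomial split: if_splits)
  then show ?thesis by simp
qed

lemma divide_monomial_mult: "divide_monomial u (Poly_Mapping.single u 1 * p) = p"
  by (induction p rule: poly_mapping_additive_induct)
    (simp_all add: divide_monomial_zero divide_monomial_add distrib_left mult_single
      add.commute[of u] divide_monomial_single)

text \<open>
  For coprime \<open>u\<close> and \<open>u'\<close>, a monomial is divisible by \<open>u\<close> if and only if its product with
  \<open>u'\<close> is.
\<close>

lemma divide_monomial_mult_coprime:
  assumes "Poly_Mapping.keys u \<inter> Poly_Mapping.keys u' = {}"
  shows "divide_monomial u (Poly_Mapping.single u' 1 * p) = Poly_Mapping.single u' 1 * divide_monomial u p"
proof (induction p rule: poly_mapping_additive_induct)
  case (single \<mu> c)
  show ?case
  proof (cases "\<exists>\<nu>. \<mu> = \<nu> + u")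
    case True
    then obtain \<nu> where \<nu>: "\<mu> = \<nu> + u" ..
    show ?thesis
      unfolding \<nu> by (simp add: mult_single divide_monomial_single flip: add.assoc)
  next
    case False
    have "u' + \<mu> \<noteq> \<nu> + u" for \<nu>
    proof
      assume eq: "u' + \<mu> = \<nu> + u"
      have "\<mu> = (\<mu> - u) + u"
      proof (rule poly_mapping_eqI)
        fix v
        have "Poly_Mapping.lookup u' v + Poly_Mapping.lookup \<mu> v =
            Poly_Mapping.lookup \<nu> v + Poly_Mapping.lookup u v"
          using eq by (metis lookup_add)
        moreover have "Poly_Mapping.lookup u v = 0 \<or> Poly_Mapping.lookup u' v = 0"
          using assms by (auto simp: in_keys_iff)
        ultimately show "Poly_Mapping.lookup \<mu> v = Poly_Mapping.lookup (\<mu> - u + u) v"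
          by (auto simp: lookup_add lookup_minus)
      qed
      then show False using False by blast
    qed
    then show ?thesis
      using False by (simp add: mult_single divide_monomial_single_0)
  qed
qed (simp_all add: divide_monomial_zero divide_monomial_add distrib_left)

lemma divide_monomial_in: "p \<in> polys_in V \<Longrightarrow> divide_monomial u p \<in> polys_in V"
  by (force simp: polys_in_def keys_divide_monomial keys_add_nat)

locale coprime_leading_monomials = graded_monomials deg
  for deg :: "('v \<Rightarrow>\<^sub>0 nat) \<Rightarrow> nat" +
  fixes V :: "'v set" and \<Lambda> :: "'i set" and u :: "'i \<Rightarrow> 'v \<Rightarrow>\<^sub>0 nat"
    and f :: "'i \<Rightarrow> ('v, 'k::field) mpoly"
  assumes finite_index: "finite \<Lambda>"
    and f_mem: "i \<in> \<Lambda> \<Longrightarrow> f i \<in> polys_in V"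
    and f_leads: "i \<in> \<Lambda> \<Longrightarrow> leads (u i) (f i)"
    and u_nonzero: "i \<in> \<Lambda> \<Longrightarrow> u i \<noteq> 0"
    and u_coprime: "i \<in> \<Lambda> \<Longrightarrow> j \<in> \<Lambda> \<Longrightarrow> i \<noteq> j \<Longrightarrow> Poly_Mapping.keys (u i) \<inter> Poly_Mapping.keys (u j) = {}"
begin

text \<open>
  The largest power of \<open>u i\<close> that divides \<open>\<mu>\<close>.
\<close>

definition order_at :: "'i \<Rightarrow> ('v \<Rightarrow>\<^sub>0 nat) \<Rightarrow> nat" where
  "order_at i \<mu> =
     Min ((\<lambda>v. Poly_Mapping.lookup \<mu> v div Poly_Mapping.lookup (u i) v) ` Poly_Mapping.keys (u i))"

definition cofactor :: "('v \<Rightarrow>\<^sub>0 nat) \<Rightarrow> ('v \<Rightarrow>\<^sub>0 nat)" where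
  "cofactor \<mu> = \<mu> - (\<Sum>i\<in>\<Lambda>. \<Sum>_<order_at i \<mu>. u i)"

definition basis :: "('v \<Rightarrow>\<^sub>0 nat) \<Rightarrow> ('v, 'k) mpoly" where
  "basis \<mu> = Poly_Mapping.single (cofactor \<mu>) 1 * (\<Prod>i\<in>\<Lambda>. f i ^ order_at i \<mu>)"

lemma keys_u_nonempty: "i \<in> \<Lambda> \<Longrightarrow> Poly_Mapping.keys (u i) \<noteq> {}"
  using u_nonzero[of i] by simp

lemma order_at_add_same:
  assumes "i \<in> \<Lambda>"
  shows "order_at i (\<mu> + u i) = Suc (order_at i \<mu>)"
proof -
  let ?q = "\<lambda>v. Poly_Mapping.lookup \<mu> v div Poly_Mapping.lookup (u i) v"
  have "(\<lambda>v. Poly_Mapping.lookup (\<mu> + u i) v div Poly_Mapping.lookup (u i) v) ` Poly_Mapping.keys (u i) =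
      Suc ` ?q ` Poly_Mapping.keys (u i)"
    unfolding image_image by (intro image_cong) (auto simp: lookup_add in_keys_iff)
  then show ?thesis
    using keys_u_nonempty[OF assms]
    by (simp add: order_at_def mono_Min_commute[of Suc] mono_Suc)
qed

lemma lookup_u_other:
  "i \<in> \<Lambda> \<Longrightarrow> j \<in> \<Lambda> \<Longrightarrow> i \<noteq> j \<Longrightarrow> v \<in> Poly_Mapping.keys (u i) \<Longrightarrow> Poly_Mapping.lookup (u j) v = 0"
  using u_coprime[of i j] by (metis disjoint_iff in_keys_iff)

lemma order_at_add_other:
  assumes "i \<in> \<Lambda>" "j \<in> \<Lambda>" "i \<noteq> j"
  shows "order_at i (\<mu> + u j) = order_at i \<mu>"
  unfolding order_at_def
  by (intro arg_cong[of _ _ Min] image_cong) (auto simp: lookup_add lookup_u_other[OF assms])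

text \<open>
  The powers of the \<open>u i\<close> dividing \<open>\<mu>\<close> have disjoint supports, so their product divides \<open>\<mu>\<close>
  and the subtraction in \<open>cofactor\<close> is not truncated.
\<close>

lemma cofactor_add: "cofactor \<mu> + (\<Sum>i\<in>\<Lambda>. \<Sum>_<order_at i \<mu>. u i) = \<mu>"
proof (rule poly_mapping_eqI)
  fix v
  have "(\<Sum>i\<in>\<Lambda>. order_at i \<mu> * Poly_Mapping.lookup (u i) v) \<le> Poly_Mapping.lookup \<mu> v"
  proof (cases "\<exists>i\<in>\<Lambda>. v \<in> Poly_Mapping.keys (u i)")
    case True
    then obtain i where i: "i \<in> \<Lambda>" "v \<in> Poly_Mapping.keys (u i)" by auto
    have "Poly_Mapping.lookup (u j) v = 0" if "j \<in> \<Lambda> - {i}" for j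
      using i that by (intro lookup_u_other[of i]) auto
    then have "(\<Sum>j\<in>\<Lambda>. order_at j \<mu> * Poly_Mapping.lookup (u j) v) =
        order_at i \<mu> * Poly_Mapping.lookup (u i) v"
      using i(1) finite_index by (simp add: sum.remove[of \<Lambda> i])
    also have "\<dots> \<le> (Poly_Mapping.lookup \<mu> v div Poly_Mapping.lookup (u i) v) * Poly_Mapping.lookup (u i) v"
      unfolding order_at_def using i(2) by (intro mult_right_mono Min_le) auto
    also have "\<dots> \<le> Poly_Mapping.lookup \<mu> v" by simp
    finally show ?thesis .
  next
    case False
    then show ?thesis by (simp add: in_keys_iff)
  qed
  then show "Poly_Mapping.lookup (cofactor \<mu> + (\<Sum>i\<in>\<Lambda>. \<Sum>_<order_at i \<mu>. u i)) v =
      Poly_Mapping.lookup \<mu> v"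
    by (simp add: cofactor_def lookup_add lookup_minus lookup_sum)
qed

text \<open>
  Since the \<open>u j\<close> are coprime, multiplying a monomial by \<open>u i\<close> raises the exponent of \<open>u i\<close> by one
  and changes neither the other exponents nor the cofactor.
\<close>

lemma basis_add:
  assumes i: "i \<in> \<Lambda>"
  shows "basis (\<mu> + u i) = f i * basis \<mu>"
proof -
  have "(\<Prod>j\<in>\<Lambda>. f j ^ order_at j (\<mu> + u i)) =
      f i ^ order_at i (\<mu> + u i) * (\<Prod>j\<in>\<Lambda> - {i}. f j ^ order_at j (\<mu> + u i))"
    using i finite_index by (rule prod.remove[rotated])
  also have "(\<Prod>j\<in>\<Lambda> - {i}. f j ^ order_at j (\<mu> + u i)) = (\<Prod>j\<in>\<Lambda> - {i}. f j ^ order_at j \<mu>)"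
    using i by (intro prod.cong) (auto simp: order_at_add_other)
  also have "f i ^ order_at i (\<mu> + u i) * \<dots> = f i * (\<Prod>j\<in>\<Lambda>. f j ^ order_at j \<mu>)"
    using i finite_index by (simp add: order_at_add_same prod.remove[of \<Lambda> i] mult.assoc)
  finally have f: "(\<Prod>j\<in>\<Lambda>. f j ^ order_at j (\<mu> + u i)) = f i * (\<Prod>j\<in>\<Lambda>. f j ^ order_at j \<mu>)" .
  have "(\<Sum>j\<in>\<Lambda>. \<Sum>_<order_at j (\<mu> + u i). u j) =
      (\<Sum>_<order_at i (\<mu> + u i). u i) + (\<Sum>j\<in>\<Lambda> - {i}. \<Sum>_<order_at j (\<mu> + u i). u j)"
    using i finite_index by (rule sum.remove[rotated])
  also have "(\<Sum>j\<in>\<Lambda> - {i}. \<Sum>_<order_at j (\<mu> + u i). u j) = (\<Sum>j\<in>\<Lambda> - {i}. \<Sum>_<order_at j \<mu>. u j)"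
    using i by (intro sum.cong) (auto simp: order_at_add_other)
  also have "(\<Sum>_<order_at i (\<mu> + u i). u i) + \<dots> = u i + (\<Sum>j\<in>\<Lambda>. \<Sum>_<order_at j \<mu>. u j)"
    using i finite_index by (simp add: order_at_add_same sum.remove[of \<Lambda> i] ac_simps)
  finally have "cofactor (\<mu> + u i) = cofactor \<mu>"
    by (simp add: cofactor_def add.commute[of \<mu>])
  then show ?thesis by (simp add: basis_def f mult.left_commute)
qed

lemma basis_leads: "leads \<mu> (basis \<mu>)"
proof -
  have "leads (\<Sum>i\<in>\<Lambda>. \<Sum>_<order_at i \<mu>. u i) (\<Prod>i\<in>\<Lambda>. f i ^ order_at i \<mu>)"
    by (rule leads_prod[OF finite_index leads_power[OF f_leads]])
  from leads_mult[OF leads_single this]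
  have "leads (cofactor \<mu> + (\<Sum>i\<in>\<Lambda>. \<Sum>_<order_at i \<mu>. u i)) (basis \<mu>)"
    unfolding basis_def .
  then show ?thesis unfolding cofactor_add .
qed

sublocale unitriangular_basis deg basis
  by unfold_locales (rule basis_leads)

lemma basis_mem:
  assumes "Poly_Mapping.keys \<mu> \<subseteq> W" "\<And>i. i \<in> \<Lambda> \<Longrightarrow> f i \<in> polys_in W"
  shows "basis \<mu> \<in> polys_in W"
proof -
  interpret unital_subring "polys_in W :: ('v, 'k) mpoly set" by (rule polys_in_subring)
  have "Poly_Mapping.keys (cofactor \<mu>) \<subseteq>
      Poly_Mapping.keys (cofactor \<mu> + (\<Sum>i\<in>\<Lambda>. \<Sum>_<order_at i \<mu>. u i))"
    unfolding keys_add_nat by blast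
  then have "Poly_Mapping.keys (cofactor \<mu>) \<subseteq> Poly_Mapping.keys \<mu>"
    unfolding cofactor_add .
  then show ?thesis
    unfolding basis_def using assms by (intro mult_mem prod_mem power_mem single_in_polys_in) auto
qed

text \<open>
  The linear extension \<open>\<Phi>\<close> of \<open>basis\<close> is a bijection under which multiplication by \<open>u i\<close> corresponds
  to multiplication by \<open>f i\<close>. Division by \<open>u i\<close> is a retraction for the former that commutes with
  multiplication by the other \<open>u j\<close>, and its conjugate by \<open>\<Phi>\<close> is the required operator.
\<close>

theorem ex_retracted_family: "\<exists>D. retracted_family (polys_in V) \<Lambda> f D"
proof -
  let ?\<Phi> = "linear_extension basis"
  define D where "D i x = ?\<Phi> (divide_monomial (u i) (inv_into UNIV ?\<Phi> x))" for i x
  interpret unital_subring "polys_in V :: ('v, 'k) mpoly set" by (rule polys_in_subring)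
  have inv1: "inv_into UNIV ?\<Phi> (?\<Phi> x) = x" for x by (rule inv_f_f[OF linear_extension_inj])
  have surj: "\<exists>y. x = ?\<Phi> y" for x
    using linear_extension_surj[of UNIV x] basis_mem[of _ UNIV] by (auto simp: polys_in_def)
  have mult: "?\<Phi> (Poly_Mapping.single (u i) 1 * x) = f i * ?\<Phi> x" if "i \<in> \<Lambda>" for i x
    using that by (intro linear_extension_mult basis_add)
  have "retracted_family (polys_in V) \<Lambda> f D"
  proof
    fix i x assume i: "i \<in> \<Lambda>"
    obtain x' where x': "x = ?\<Phi> x'" using surj by blast
    show "D i (f i * x) = x"
      unfolding x' by (simp add: D_def inv1 divide_monomial_mult flip: mult[OF i])
    show "D i (x + y) = D i x + D i y" for y
    proof -
      obtain y' where y': "y = ?\<Phi> y'" using surj by blast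
      show ?thesis
        unfolding x' y'
        by (simp add: D_def inv1 linear_extension_add divide_monomial_add flip: linear_extension_add)
    qed
    show "D i (f j * x) = f j * D i x" if j: "j \<in> \<Lambda>" "i \<noteq> j" for j
      unfolding x'
      by (simp add: D_def inv1 divide_monomial_mult_coprime[OF u_coprime[OF i j]] flip: mult[OF j(1)])
  next
    fix i and x :: "('v, 'k) mpoly" assume i: "i \<in> \<Lambda>" and x: "x \<in> polys_in V"
    obtain y where y: "y \<in> polys_in V" "?\<Phi> y = x"
      using linear_extension_surj[OF _ x] basis_mem[OF _ f_mem] by blast
    have "divide_monomial (u i) y \<in> polys_in V" by (rule divide_monomial_in[OF y(1)])
    then have "?\<Phi> (divide_monomial (u i) y) \<in> polys_in V"
      unfolding linear_extension_def
      by (intro sum_mem mult_mem basis_mem f_mem single_in_polys_in) (auto simp: polys_in_def)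
    then show "D i x \<in> polys_in V"
      using y(2) inv1[of y] by (simp add: D_def)
  qed (use finite_index f_mem in auto)
  then show ?thesis by (intro exI[of _ D])
qed

end

section \<open>The entries of the product of the generic matrices\<close>

definition weighted_degree :: "('v \<Rightarrow> nat) \<Rightarrow> ('v \<Rightarrow>\<^sub>0 nat) \<Rightarrow> nat" where
  "weighted_degree w \<mu> = (\<Sum>v\<in>Poly_Mapping.keys \<mu>. w v * Poly_Mapping.lookup \<mu> v)"

lemma weighted_degree_add: "weighted_degree w (\<mu> + \<nu>) = weighted_degree w \<mu> + weighted_degree w \<nu>"
  unfolding weighted_degree_def by (rule setsum_keys_plus_distrib) (auto simp: distrib_left)

lemma weighted_degree_single: "weighted_degree w (Poly_Mapping.single v a) = w v * a"
  by (simp add: weighted_degree_def)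

lemma lookup_0_mult:
  fixes p q :: "('v, 'k::field) mpoly"
  assumes "Poly_Mapping.lookup p 0 = 0"
  shows "Poly_Mapping.lookup (p * q) 0 = 0"
proof (rule ccontr)
  assume "Poly_Mapping.lookup (p * q) 0 \<noteq> 0"
  then have "0 \<in> Poly_Mapping.keys (p * q)" by (simp add: in_keys_iff)
  then obtain a b where ab: "0 = a + b" "a \<in> Poly_Mapping.keys p"
    using keys_mult[of p q] by auto
  have "Poly_Mapping.keys a = {}"
    using keys_add_nat[of a b] ab(1) by simp
  then have "a = 0" by simp
  then show False using ab(2) assms by (simp add: in_keys_iff)
qed

definition xy_monomial :: "nat \<Rightarrow> nat \<Rightarrow> nat \<Rightarrow> xy \<Rightarrow>\<^sub>0 nat" where
  "xy_monomial i k j = Poly_Mapping.single (XV i k) 1 + Poly_Mapping.single (YV k j) 1"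

text \<open>
  The weight for which the terms of \<open>g m n i j\<close> have weight two, one or zero according to whether both,
  one or none of the two coordinates of \<open>k\<close> (its block \<open>k div m\<close> and its position \<open>k mod m\<close> in the
  block) match \<open>j\<close> and \<open>i\<close>.
\<close>

definition block_weight :: "nat \<Rightarrow> xy \<Rightarrow> nat" where
  "block_weight m v = (case v of XV i k \<Rightarrow> of_bool (k mod m = i) | YV k j \<Rightarrow> of_bool (k div m = j))"

lemma g_eq: "g m n i j = (\<Sum>k<m * n. Poly_Mapping.single (xy_monomial i k j) 1)"
  by (simp add: g_def mvar_def mult_single xy_monomial_def)

lemma keys_xy_monomial: "Poly_Mapping.keys (xy_monomial i k j) = {XV i k, YV k j}"
  by (auto simp: xy_monomial_def keys_add_nat)

lemma xy_monomial_nonzero: "xy_monomial i k j \<noteq> 0"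
  using keys_xy_monomial[of i k j] by auto

lemma g_mem: "i < m \<Longrightarrow> j < n \<Longrightarrow> g m n i j \<in> polys_in (xy_vars m n)"
  unfolding g_eq using polys_in_subring
  by (rule unital_subring.sum_mem) (auto intro!: single_in_polys_in simp: keys_xy_monomial xy_vars_def)

lemma lookup_0_g: "Poly_Mapping.lookup (g m n i j) 0 = 0"
  by (simp add: g_eq lookup_sum lookup_single_not_eq[OF xy_monomial_nonzero])

lemma diagonal_index_less:
  fixes m :: nat
  assumes "i < m" "j < n"
  shows "m * j + i < m * n"
proof -
  have "m * j + i < m * Suc j" using assms(1) by simp
  also have "\<dots> \<le> m * n" using assms(2) by (intro mult_le_mono2) simp
  finally show ?thesis .
qed

text \<open>
  Only \<open>k = m * j + i\<close> has position \<open>i\<close> and block \<open>j\<close>. The leading monomials for different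
  \<open>(i, j)\<close> share no variable because this \<open>k\<close> determines \<open>i\<close> and \<open>j\<close>.
\<close>

lemma coprime_leading_monomials_g:
  "coprime_leading_monomials (weighted_degree (block_weight m)) (xy_vars m n) ({..<m} \<times> {..<n})
     (\<lambda>(i, j). xy_monomial i (m * j + i) j) (\<lambda>(i, j). g m n i j :: (xy, 'k::field) mpoly)"
proof -
  interpret graded_monomials "weighted_degree (block_weight m)"
    by unfold_locales (rule weighted_degree_add)
  have leads: "leads (xy_monomial i (m * j + i) j) (g m n i j :: (xy, 'k) mpoly)"
    if ij: "i < m" "j < n" for i j
  proof -
    let ?k = "m * j + i"
    have deg: "weighted_degree (block_weight m) (xy_monomial i k j) =
        of_bool (k mod m = i) + of_bool (k div m = j)" for k
      by (simp add: xy_monomial_def weighted_degree_add weighted_degree_single block_weight_def)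
    have "g m n i j - Poly_Mapping.single (xy_monomial i ?k j) 1 =
        (\<Sum>k\<in>{..<m * n} - {?k}. Poly_Mapping.single (xy_monomial i k j) 1 :: (xy, 'k) mpoly)"
      unfolding g_eq using diagonal_index_less[OF ij] by (simp add: sum.remove[of _ ?k])
    moreover have "below 2 (Poly_Mapping.single (xy_monomial i k j) 1 :: (xy, 'k) mpoly)"
      if "k \<noteq> ?k" for k
    proof -
      have "\<not> (k mod m = i \<and> k div m = j)"
        using that mult_div_mod_eq[of m k] by auto
      then show ?thesis by (auto simp: below_def deg)
    qed
    ultimately have "below 2 (g m n i j - Poly_Mapping.single (xy_monomial i ?k j) 1 :: (xy, 'k) mpoly)"
      by (auto intro!: below_sum)
    moreover have "weighted_degree (block_weight m) (xy_monomial i ?k j) = 2"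
      using ij by (simp add: deg)
    ultimately show ?thesis by (simp add: leads_def)
  qed
  show ?thesis
    by unfold_locales (auto simp: leads g_mem xy_monomial_nonzero keys_xy_monomial)
qed

text \<open>
  Moving a block to the front permutes the indices, so the product of the rearranged matrices has the
  same entries as the corresponding column of the original product.
\<close>

lemma mset_block_first:
  assumes "s < n"
  shows "mset (block_first m n s) = mset [0..<m * n]"
proof -
  have concat: "mset (concat (map (block m) [0..<k])) = mset [0..<m * k]" for k
  proof (induction k)
    case (Suc k)
    have "[0..<m * Suc k] = [0..<m * k] @ block m k"
      using upt_add_eq_append[of 0 "m * k" m] by (simp add: block_def add.commute)
    then show ?case using Suc.IH by simp
  qed simp
  have mset_concat: "mset (concat xs) = sum_list (map mset xs)" for xs :: "nat list list"
    by (induction xs) auto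
  have "mset (s # filter (\<lambda>u. u \<noteq> s) [0..<n]) = mset [0..<n]"
  proof (rule set_eq_iff_mset_eq_distinct[THEN iffD1])
    show "set (s # filter (\<lambda>u. u \<noteq> s) [0..<n]) = set [0..<n]" using assms by auto
  qed auto
  then have "mset (concat (map (block m) (s # filter (\<lambda>u. u \<noteq> s) [0..<n]))) =
      mset (concat (map (block m) [0..<n]))"
    unfolding mset_concat map_map sum_mset_sum_list[symmetric] mset_map by simp
  then show ?thesis by (simp add: block_first_def concat)
qed

lemma length_block_first: "s < n \<Longrightarrow> length (block_first m n s) = m * n"
  using mset_block_first[THEN arg_cong[of _ _ size]] by simp

lemma sum_block_first:
  fixes F :: "nat \<Rightarrow> 'a::comm_monoid_add"
  assumes "s < n"
  shows "(\<Sum>k<m * n. F (block_first m n s ! k)) = (\<Sum>k<m * n. F k)"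
proof -
  have "(\<Sum>k<m * n. F (block_first m n s ! k)) = sum_list (map F (block_first m n s))"
    using length_block_first[OF assms] by (simp add: sum_list_sum_nth atLeast0LessThan)
  also have "\<dots> = sum_mset (image_mset F (mset (block_first m n s)))"
    by (simp flip: sum_mset_sum_list)
  also have "\<dots> = sum_list (map F [0..<m * n])"
    unfolding mset_block_first[OF assms] by (simp flip: sum_mset_sum_list)
  also have "\<dots> = (\<Sum>k<m * n. F k)"
    by (simp add: sum_list_sum_nth atLeast0LessThan)
  finally show ?thesis .
qed

lemma block_first_less: "s < n \<Longrightarrow> k < m * n \<Longrightarrow> block_first m n s ! k < m * n"
  using mset_block_first[THEN mset_eq_setD, of s n m] length_block_first[of s n m]
    nth_mem[of k "block_first m n s"] by auto

lemma elements_brX_brY: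
  assumes "s < n"
  shows "elements_mat (brX m n s * brY m n s :: (xy, 'k::field) mpoly mat) = (\<lambda>i. g m n i s) ` {..<m}"
proof -
  have "(brX m n s * brY m n s) $$ (i, 0) = (g m n i s :: (xy, 'k) mpoly)" if "i < m" for i
  proof -
    have "(brX m n s * brY m n s) $$ (i, 0) =
        (\<Sum>k<m * n. mvar (XV i (block_first m n s ! k)) * mvar (YV (block_first m n s ! k) s)
          :: (xy, 'k) mpoly)"
      using that assms block_first_less[OF assms]
      by (auto simp: brX_def brY_def genX_def genY_def scalar_prod_def atLeast0LessThan intro!: sum.cong)
    also have "\<dots> = g m n i s"
      unfolding g_def by (rule sum_block_first[OF assms])
    finally show ?thesis .
  qed
  then show ?thesis
    by (force simp: elements_mat_def brX_def brY_def)
qed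

lemma elements_genX_genY:
  "elements_mat (genX m n * genY m n :: (xy, 'k::field) mpoly mat) =
     (\<lambda>(i, j). g m n i j) ` ({..<m} \<times> {..<n})"
proof -
  have "(genX m n * genY m n) $$ (i, j) = (g m n i j :: (xy, 'k) mpoly)" if "i < m" "j < n" for i j
    using that
    by (auto simp: g_def genX_def genY_def scalar_prod_def atLeast0LessThan intro!: sum.cong)
  then show ?thesis
    by (force simp: elements_mat_def genX_def genY_def)
qed

text \<open>
  The three claims are the consequences of the retractions for the family of all \<open>g m n i j\<close>. The order
  of the sequence does not matter, as a retracted family can be listed in any order. The ideal generated
  is proper because every \<open>g m n i j\<close> has constant term zero.
\<close>

theorem theorem7p4:
  fixes m n :: nat
  assumes "m \<ge> 1" and "n \<ge> 1"
  shows "let R = (Rxy m n :: (xy, 'k::field) mpoly ring);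
             \<II> = I1 R (genX m n * genY m n) in
         (\<forall>t. 1 \<le> t \<and> t \<le> n - 1 \<longrightarrow>
            P m n t \<inter> I1 R (brX m n t * brY m n t) =
            ideal_prod R (P m n t) (I1 R (brX m n t * brY m n t))) \<and>
         (\<forall>ps. distinct ps \<and> set ps = {..<m} \<times> {..<n} \<longrightarrow>
            (let gs = map (\<lambda>(i, j). g m n i j) ps in
               regular_sequence R gs \<and>
               minimal_free_resolution R (irrelevant_ideal m n)
                 (koszul_module R gs) (koszul_diff R gs) (koszul_aug R \<II>)
                 (quotient_module R \<II>)))"
proof -
  let ?V = "xy_vars m n" and ?R = "Rxy m n :: (xy, 'k) mpoly ring"
  let ?C = "polys_in ?V :: (xy, 'k) mpoly set" and ?\<Lambda> = "{..<m} \<times> {..<n}"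
  let ?g = "\<lambda>(i, j). g m n i j :: (xy, 'k) mpoly"
  let ?I = "I1 ?R (genX m n * genY m n)"
  interpret R: explicit_ring ?C ?R
    unfolding Rxy_def by (rule explicit_ring_mpoly_ring)
  obtain D where "retracted_family ?C ?\<Lambda> ?g D"
    using coprime_leading_monomials.ex_retracted_family[OF coprime_leading_monomials_g] by blast
  then interpret D: retracted_family ?C ?\<Lambda> ?g D .
  have column: "I1 ?R (brX m n t * brY m n t) = comb_span ?C ?g ({..<m} \<times> {t})" if "t < n" for t
  proof -
    have "elements_mat (brX m n t * brY m n t :: (xy, 'k) mpoly mat) = ?g ` ({..<m} \<times> {t})"
      unfolding elements_brX_brY[OF that] by force
    then show ?thesis
      unfolding I1_def using that by (simp only:) (rule R.genideal_eq_comb_span, auto intro: g_mem)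
  qed
  have P_span: "P m n t = comb_span ?C ?g ({..<m} \<times> {..<t})" if "t \<le> n" for t
    using that
  proof (induction t)
    case 0
    then show ?case by (auto simp: comb_span_def R.zero_eq)
  next
    case (Suc t)
    have "{..<m} \<times> {..<Suc t} = {..<m} \<times> {..<t} \<union> {..<m} \<times> {t}" by auto
    then show ?case
      using Suc by (simp add: column comb_span_union[OF R.add_eq] disjoint_iff)
  qed
  have inter: "P m n t \<inter> I1 ?R (brX m n t * brY m n t) =
      ideal_prod ?R (P m n t) (I1 ?R (brX m n t * brY m n t))" if "1 \<le> t \<and> t \<le> n - 1" for t
  proof -
    have t: "t < n" using that by linarith
    then have "{..<m} \<times> {..<t} \<subseteq> ?\<Lambda>" "{..<m} \<times> {t} \<subseteq> ?\<Lambda>"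
        "({..<m} \<times> {..<t}) \<inter> ({..<m} \<times> {t}) = {}"
      by auto
    from R.inter_eq_ideal_prod_if_retracted[OF D.retracted_family_axioms this]
    show ?thesis using t by (simp add: P_span column)
  qed
  interpret irr: ideal "irrelevant_ideal m n :: (xy, 'k) mpoly set" ?R
    unfolding irrelevant_ideal_def
    by (rule R.R.genideal_ideal) (auto simp: R.carrier_eq mvar_def intro!: single_in_polys_in)
  have mvar: "(mvar v :: (xy, 'k) mpoly) \<in> ?C" if "v \<in> ?V" for v
    using that by (auto simp: mvar_def intro!: single_in_polys_in)
  have g_irr: "(g m n i j :: (xy, 'k) mpoly) \<in> irrelevant_ideal m n" if "i < m" "j < n" for i j
    unfolding g_def
  proof (rule R.ideal_sum[OF irr.ideal_axioms])
    fix k assume "k \<in> {..<m * n}"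
    then have v: "XV i k \<in> ?V" "YV k j \<in> ?V" using that by (auto simp: xy_vars_def)
    have "(mvar (XV i k) :: (xy, 'k) mpoly) \<in> irrelevant_ideal m n"
      unfolding irrelevant_ideal_def using v(1) mvar
      by (intro subsetD[OF R.R.genideal_self]) (auto simp: R.carrier_eq)
    from irr.I_r_closed[OF this, of "mvar (YV k j)"]
    show "(mvar (XV i k) * mvar (YV k j) :: (xy, 'k) mpoly) \<in> irrelevant_ideal m n"
      using mvar[OF v(2)] by (simp add: R.ring_eqs)
  qed
  have main: "regular_sequence ?R gs \<and> minimal_free_resolution ?R (irrelevant_ideal m n)
      (koszul_module ?R gs) (koszul_diff ?R gs) (koszul_aug ?R ?I) (quotient_module ?R ?I)"
    if ps: "distinct ps" "set ps = ?\<Lambda>" and gs: "gs = map ?g ps" for ps gs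
  proof -
    have retr: "retracted_family ?C {..<length gs} ((!) gs) (\<lambda>k. D (ps ! k))"
      unfolding gs by (rule D.reindex_list[OF ps])
    have set_gs: "set gs = ?g ` ?\<Lambda>" unfolding gs using ps(2) by simp
    have span: "Idl\<^bsub>?R\<^esub> (set gs) = comb_span ?C ?g ?\<Lambda>"
      unfolding set_gs by (rule R.genideal_eq_comb_span) (auto intro: g_mem)
    have "Poly_Mapping.lookup x 0 = 0" if "x \<in> comb_span ?C ?g ?\<Lambda>" for x
      using that by (auto simp: lookup_sum lookup_0_mult lookup_0_g elim!: comb_spanE intro!: sum.neutral)
    then have "1 \<notin> comb_span ?C ?g ?\<Lambda>" by fastforce
    then have "Idl\<^bsub>?R\<^esub> (set gs) \<noteq> carrier ?R"
      unfolding span using R.one_mem by (auto simp: R.carrier_eq)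
    moreover have "?I = Idl\<^bsub>?R\<^esub> (set gs)"
      by (simp add: I1_def elements_genX_genY set_gs)
    moreover have "set gs \<subseteq> irrelevant_ideal m n"
      unfolding set_gs using g_irr by auto
    ultimately show ?thesis
      using R.regular_sequence_if_retracted[OF retr]
        R.koszul_resolution_if_retracted[OF retr _ irr.ideal_axioms] by simp
  qed
  show ?thesis
    unfolding Let_def using inter main by blast
qed

end
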